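(* Let $X$ be a diffeological space and let $F$ be either the cotangent space $T^*X$ or the internal tangent space ${}^iTX$, viewed as a diffeological vector pseudo-bundle over $X$. Let $\{F_i\,|\,i\in I\}$ be the collection of pairwise non-isomorphic fibers of $F$, and let $X_{F_i}=\{x\in X\,|\,\pi^{-1}(x)\text{ is isomorphic to }F_i\}$. Then any diffeomorphism $\varphi$ of $X$ smoothly homotopic to the identity map leaves the connected components of each $X_{F_i}$ globally invariant. In particular, an isolated $F$-singularity is a fixed point for $\varphi$.
   Context: Smooth homotopy: $\varphi\in\mathrm{Diff}(X)$ is smoothly homotopic to the identity if there is a smooth path $t\mapsto\varphi_t$ in $\mathrm{Diff}(X)$ (with the functional diffeology making evaluation and inversion smooth) with $\varphi_0=\mathrm{Id}_X$, $\varphi_1=\varphi$. Diffeological vector pseudo-bundle: a smooth surjective subduction $\pi:F\to X$ with smooth fiberwise addition and scalar multiplication making each fiber a diffeological vector space (no local triviality or typical fiber assumed). It is a diffeological vector bundle if all fibers are isomorphic as diffeological vector spaces. Cotangent space: $\Omega^1(X)$ is the space of families $\alpha=(\alpha_p)_p$ of 1-forms $\alpha_p$ on the domain of each plot $p$ with $\alpha_{p\circ g}=g^*\alpha_p$ for smooth $g$, with its functional diffeology ($t\mapsto\alpha^t$ is a plot iff for each plot $p$ the form $\alpha^t_p$ is jointly smooth). $T^*X$ is the quotient of $X\times\Omega^1(X)$, with the quotient diffeology, by $(x,\alpha)\sim(x,\beta)$ iff $\alpha_p(0)=\beta_p(0)$ for every plot $p$ with $0$ in its domain and $p(0)=x$.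 Internal tangent space: ${}^iT_xX$ is the colimit of the $T_0U$ over plots $p:U\to X$ ($U$ a connected open neighbourhood of $0$ in some $\mathbb R^n$) with $p(0)=x$, the arrows being germs at $0$ of smooth maps $g$ with $g(0)=0$ and $p=p'\circ g$ (acting by $dg_0$). ${}^iTX=\coprod_x{}^iT_xX$ has the smallest diffeology containing the natural maps $TU\to{}^iTX$ induced by plots $U\to X$ and making fiberwise addition, scalar multiplication and the zero section smooth. An $F$-singularity is a point $x\in X$ such that there exists no base of neighborhoods $\{V_k\,|\,k\in K\}$ of $x$ in the D-topology (finest topology making all plots continuous) such that for all $k\in K$, $\pi^{-1}(V_k)$ is a vector bundle with typical fiber $\pi^{-1}(x)$. An isolated $F$-singularity is an $F$-singularity which is an isolated point of the set of $F$-singularities for the D-topology. Connected components are with respect to the D-topology. *)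

theory Defs
  imports "HOL-Analysis.Analysis" "HOL-Library.Function_Algebras"
begin

section \<open>Smooth maps between open subsets of Euclidean spaces of arbitrary dimension\<close>

text \<open>
  The space of dimension \<open>n\<close> is the library's \<open>Euclidean_space n\<close>: the functions
  \<open>nat \<Rightarrow> real\<close> vanishing from index \<open>n\<close> on, with the topology of pointwise convergence.
  This makes the dimension an ordinary natural number, so that one can quantify over plots
  of all dimensions.
\<close>

type_synonym euc = "nat \<Rightarrow> real"

abbreviation Euc :: "nat \<Rightarrow> euc set" where
  "Euc n \<equiv> topspace (Euclidean_space n)"

definition partial :: "nat \<Rightarrow> (euc \<Rightarrow> real) \<Rightarrow> euc \<Rightarrow> real" where
  "partial i f x = deriv (\<lambda>t. f (x(i := t))) (x i)"

primrec Ck_on :: "nat \<Rightarrow> nat \<Rightarrow> euc set \<Rightarrow> (euc \<Rightarrow> real) \<Rightarrow> bool" where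
  "Ck_on 0 n U f \<longleftrightarrow> continuous_map (subtopology (Euclidean_space n) U) euclideanreal f"
| "Ck_on (Suc k) n U f \<longleftrightarrow>
     continuous_map (subtopology (Euclidean_space n) U) euclideanreal f \<and>
     (\<forall>i<n. (\<forall>x\<in>U. (\<lambda>t. f (x(i := t))) field_differentiable at (x i)) \<and> Ck_on k n U (partial i f))"

definition smooth_on :: "nat \<Rightarrow> euc set \<Rightarrow> (euc \<Rightarrow> real) \<Rightarrow> bool" where
  "smooth_on n U f \<longleftrightarrow> (\<forall>k. Ck_on k n U f)"

definition smooth_euc :: "nat \<Rightarrow> euc set \<Rightarrow> nat \<Rightarrow> euc set \<Rightarrow> (euc \<Rightarrow> euc) \<Rightarrow> bool" where
  "smooth_euc n U m V g \<longleftrightarrow> g \<in> U \<rightarrow> V \<and> V \<subseteq> Euc m \<and> (\<forall>i<m. smooth_on n U (\<lambda>x. g x i))"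

definition differential :: "nat \<Rightarrow> nat \<Rightarrow> (euc \<Rightarrow> euc) \<Rightarrow> euc \<Rightarrow> euc \<Rightarrow> euc" where
  "differential n m g x v = (\<lambda>i. if i < m then \<Sum>j<n. partial j (\<lambda>y. g y i) x * v j else 0)"


section \<open>Diffeological spaces\<close>

text \<open>
  A plot is a triple of the dimension, the domain and the parametrization.  Parametrizations
  are required below to be extensional (\<open>undefined\<close> off the domain), so that a plot is
  determined by its set-theoretic graph; composites are therefore written with \<open>compose\<close>.
\<close>

type_synonym 'a plot = "nat \<times> euc set \<times> (euc \<Rightarrow> 'a)"

record 'a dspace =
  points :: "'a set"
  plots :: "'a plot set"

definition diffeological_space :: "'a dspace \<Rightarrow> bool" where
  "diffeological_space X \<longleftrightarrow>
     (\<forall>(n, U, p)\<in>plots X. openin (Euclidean_space n) U \<and> p \<in> U \<rightarrow>\<^sub>E points X) \<and>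
     (\<forall>n U. \<forall>x\<in>points X. openin (Euclidean_space n) U \<longrightarrow> (n, U, \<lambda>u\<in>U. x) \<in> plots X) \<and>
     (\<forall>(n, U, p)\<in>plots X. \<forall>m V g. openin (Euclidean_space m) V \<and> smooth_euc m V n U g
        \<longrightarrow> (m, V, compose V p g) \<in> plots X) \<and>
     (\<forall>n U p. openin (Euclidean_space n) U \<and> p \<in> U \<rightarrow>\<^sub>E points X \<and>
        (\<forall>u\<in>U. \<exists>V. openin (Euclidean_space n) V \<and> u \<in> V \<and> V \<subseteq> U \<and> (n, V, restrict p V) \<in> plots X)
        \<longrightarrow> (n, U, p) \<in> plots X)"

definition smooth_map :: "'a dspace \<Rightarrow> 'b dspace \<Rightarrow> ('a \<Rightarrow> 'b) \<Rightarrow> bool" where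
  "smooth_map X Y f \<longleftrightarrow>
     f \<in> points X \<rightarrow> points Y \<and> (\<forall>(n, U, p)\<in>plots X. (n, U, compose U f p) \<in> plots Y)"

definition subduction :: "'a dspace \<Rightarrow> 'b dspace \<Rightarrow> ('a \<Rightarrow> 'b) \<Rightarrow> bool" where
  "subduction X Y f \<longleftrightarrow>
     smooth_map X Y f \<and> f ` points X = points Y \<and>
     (\<forall>(n, U, q)\<in>plots Y. \<forall>u\<in>U. \<exists>V p. u \<in> V \<and> V \<subseteq> U \<and> (n, V, p) \<in> plots X \<and>
        (\<forall>v\<in>V. q v = f (p v)))"

definition euclidean_dspace :: "nat \<Rightarrow> euc dspace" where
  "euclidean_dspace n = \<lparr> points = Euc n,
     plots = {(m, U, g). openin (Euclidean_space m) U \<and> g \<in> U \<rightarrow>\<^sub>E Euc n \<and> smooth_euc m U n (Euc n) g} \<rparr>"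

definition real_dspace :: "real dspace" where
  "real_dspace = \<lparr> points = UNIV,
     plots = {(m, U, f). openin (Euclidean_space m) U \<and> f \<in> extensional U \<and> smooth_on m U f} \<rparr>"

definition subset_dspace :: "'a dspace \<Rightarrow> 'a set \<Rightarrow> 'a dspace" where
  "subset_dspace X A = \<lparr> points = points X \<inter> A, plots = {(n, U, p)\<in>plots X. p ` U \<subseteq> A} \<rparr>"

definition prod_dspace :: "'a dspace \<Rightarrow> 'b dspace \<Rightarrow> ('a \<times> 'b) dspace" where
  "prod_dspace X Y = \<lparr> points = points X \<times> points Y,
     plots = {(n, U, p). p \<in> extensional U \<and>
        (n, U, compose U fst p) \<in> plots X \<and> (n, U, compose U snd p) \<in> plots Y} \<rparr>"

definition quotient_dspace :: "'a dspace \<Rightarrow> ('a \<times> 'a) set \<Rightarrow> 'a set dspace" where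
  "quotient_dspace X r = \<lparr> points = points X // r,
     plots = {(n, U, q). openin (Euclidean_space n) U \<and> q \<in> U \<rightarrow>\<^sub>E points X // r \<and>
        (\<forall>u\<in>U. \<exists>V p. u \<in> V \<and> V \<subseteq> U \<and> (n, V, p) \<in> plots X \<and> (\<forall>v\<in>V. q v = r `` {p v}))} \<rparr>"

definition D_open :: "'a dspace \<Rightarrow> 'a set \<Rightarrow> bool" where
  "D_open X A \<longleftrightarrow> A \<subseteq> points X \<and>
     (\<forall>(n, U, p)\<in>plots X. openin (Euclidean_space n) {u\<in>U. p u \<in> A})"

definition D_topology :: "'a dspace \<Rightarrow> 'a topology" where
  "D_topology X = topology (D_open X)"

lemma istopology_D_open: "istopology (D_open X)"
  unfolding istopology_def
proof (intro conjI allI impI)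
  fix S T assume S: "D_open X S" and T: "D_open X T"
  show "D_open X (S \<inter> T)"
    unfolding D_open_def
  proof (intro conjI ballI, goal_cases)
    case 1
    then show ?case using S by (auto simp: D_open_def)
  next
    case (2 q)
    obtain n U p where q: "q = (n, U, p)" by (cases q)
    have "{u\<in>U. p u \<in> S \<inter> T} = {u\<in>U. p u \<in> S} \<inter> {u\<in>U. p u \<in> T}"
      by blast
    moreover have "openin (Euclidean_space n) {u\<in>U. p u \<in> S}"
      using S 2 q by (auto simp: D_open_def)
    moreover have "openin (Euclidean_space n) {u\<in>U. p u \<in> T}"
      using T 2 q by (auto simp: D_open_def)
    ultimately show ?case
      by (simp only: q prod.case openin_Int)
  qed
next
  fix \<K> assume K: "\<forall>K\<in>\<K>. D_open X K"
  show "D_open X (\<Union>\<K>)"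
    unfolding D_open_def
  proof (intro conjI ballI, goal_cases)
    case 1
    then show ?case using K by (auto simp: D_open_def)
  next
    case (2 q)
    obtain n U p where q: "q = (n, U, p)" by (cases q)
    have *: "openin (Euclidean_space n) {u\<in>U. p u \<in> K}" if "K \<in> \<K>" for K
      using K that 2 q by (auto simp: D_open_def)
    have "{u\<in>U. p u \<in> \<Union>\<K>} = \<Union>((\<lambda>K. {u\<in>U. p u \<in> K}) ` \<K>)"
      by blast
    moreover have "openin (Euclidean_space n) (\<Union>((\<lambda>K. {u\<in>U. p u \<in> K}) ` \<K>))"
      using * by (intro openin_Union) auto
    ultimately show ?case
      by (simp only: q prod.case)
  qed
qed

lemma openin_D_topology: "openin (D_topology X) = D_open X"
  unfolding D_topology_def by (rule topology_inverse'[OF istopology_D_open])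

lemma topspace_D_topology:
  assumes "diffeological_space X"
  shows "topspace (D_topology X) = points X"
proof
  have "D_open X (topspace (D_topology X))"
    by (metis openin_D_topology openin_topspace)
  then show "topspace (D_topology X) \<subseteq> points X"
    by (simp add: D_open_def)
  have "openin (Euclidean_space n) {u\<in>U. p u \<in> points X}" if "(n, U, p) \<in> plots X" for n U p
  proof -
    have "openin (Euclidean_space n) U \<and> p \<in> U \<rightarrow>\<^sub>E points X"
      using assms that unfolding diffeological_space_def by fast
    moreover from this have "{u\<in>U. p u \<in> points X} = U"
      by (auto simp: PiE_iff)
    ultimately show ?thesis by simp
  qed
  then have "D_open X (points X)"
    by (auto simp: D_open_def)
  then show "points X \<subseteq> topspace (D_topology X)"
    by (metis openin_D_topology openin_subset)
qed


section \<open>Diffeomorphisms and smooth homotopy\<close>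

definition diffeomorphisms :: "'a dspace \<Rightarrow> ('a \<Rightarrow> 'a) set" where
  "diffeomorphisms X = {f \<in> extensional (points X). bij_betw f (points X) (points X) \<and>
     smooth_map X X f \<and> smooth_map X X (inv_into (points X) f)}"

definition Diff_dspace :: "'a dspace \<Rightarrow> ('a \<Rightarrow> 'a) dspace" where
  "Diff_dspace X = \<lparr> points = diffeomorphisms X,
     plots = {(n, U, P). openin (Euclidean_space n) U \<and> P \<in> U \<rightarrow>\<^sub>E diffeomorphisms X \<and>
       smooth_map (prod_dspace (subset_dspace (euclidean_dspace n) U) X) X (\<lambda>(u, x). P u x) \<and>
       smooth_map (prod_dspace (subset_dspace (euclidean_dspace n) U) X) X
         (\<lambda>(u, x). inv_into (points X) (P u) x)} \<rparr>"

definition smoothly_homotopic_to_id :: "'a dspace \<Rightarrow> ('a \<Rightarrow> 'a) \<Rightarrow> bool" where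
  "smoothly_homotopic_to_id X \<phi> \<longleftrightarrow>
     (\<exists>\<gamma>. smooth_map real_dspace (Diff_dspace X) \<gamma> \<and> \<gamma> 0 = (\<lambda>x\<in>points X. x) \<and> \<gamma> 1 = \<phi>)"


section \<open>Diffeological vector spaces and vector pseudo-bundles\<close>

record 'e dvspace =
  vspace :: "'e dspace"
  vadd :: "'e \<Rightarrow> 'e \<Rightarrow> 'e"
  vscale :: "real \<Rightarrow> 'e \<Rightarrow> 'e"
  vzero :: "'e"

definition diffeological_vector_space :: "'e dvspace \<Rightarrow> bool" where
  "diffeological_vector_space W \<longleftrightarrow>
     (let E = vspace W; S = points E; add = vadd W; scale = vscale W; z = vzero W in
       diffeological_space E \<and>
       z \<in> S \<and>
       (\<forall>a\<in>S. \<forall>b\<in>S. add a b \<in> S \<and> add a b = add b a) \<and>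
       (\<forall>a\<in>S. \<forall>b\<in>S. \<forall>c\<in>S. add (add a b) c = add a (add b c)) \<and>
       (\<forall>a\<in>S. add z a = a \<and> (\<exists>b\<in>S. add a b = z)) \<and>
       (\<forall>r. \<forall>a\<in>S. scale r a \<in> S) \<and>
       (\<forall>r. \<forall>a\<in>S. \<forall>b\<in>S. scale r (add a b) = add (scale r a) (scale r b)) \<and>
       (\<forall>r s. \<forall>a\<in>S. scale (r + s) a = add (scale r a) (scale s a)) \<and>
       (\<forall>r s. \<forall>a\<in>S. scale (r * s) a = scale r (scale s a)) \<and>
       (\<forall>a\<in>S. scale 1 a = a) \<and>
       smooth_map (prod_dspace E E) E (\<lambda>(a, b). add a b) \<and>
       smooth_map (prod_dspace real_dspace E) E (\<lambda>(r, a). scale r a))"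

definition dvs_isomorphic :: "'e dvspace \<Rightarrow> 'f dvspace \<Rightarrow> bool" where
  "dvs_isomorphic V W \<longleftrightarrow> (\<exists>f.
     bij_betw f (points (vspace V)) (points (vspace W)) \<and>
     smooth_map (vspace V) (vspace W) f \<and>
     smooth_map (vspace W) (vspace V) (inv_into (points (vspace V)) f) \<and>
     (\<forall>a\<in>points (vspace V). \<forall>b\<in>points (vspace V). f (vadd V a b) = vadd W (f a) (f b)) \<and>
     (\<forall>r. \<forall>a\<in>points (vspace V). f (vscale V r a) = vscale W r (f a)))"

record ('a, 'e) vbundle =
  base_space :: "'a dspace"
  total_space :: "'e dspace"
  proj :: "'e \<Rightarrow> 'a"
  fadd :: "'e \<Rightarrow> 'e \<Rightarrow> 'e"
  fscale :: "real \<Rightarrow> 'e \<Rightarrow> 'e"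
  fzero :: "'a \<Rightarrow> 'e"

definition fiber :: "('a, 'e) vbundle \<Rightarrow> 'a \<Rightarrow> 'e dvspace" where
  "fiber F x = \<lparr> vspace = subset_dspace (total_space F) {e. proj F e = x},
     vadd = fadd F, vscale = fscale F, vzero = fzero F x \<rparr>"

text \<open>Fiberwise addition lives on the fiber product of the total space with itself.\<close>

definition smooth_fiberwise_operations :: "('a, 'e) vbundle \<Rightarrow> bool" where
  "smooth_fiberwise_operations F \<longleftrightarrow>
     smooth_map (subset_dspace (prod_dspace (total_space F) (total_space F)) {(a, b). proj F a = proj F b})
       (total_space F) (\<lambda>(a, b). fadd F a b) \<and>
     smooth_map (prod_dspace real_dspace (total_space F)) (total_space F) (\<lambda>(r, a). fscale F r a)"

definition vector_pseudo_bundle :: "('a, 'e) vbundle \<Rightarrow> bool" where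
  "vector_pseudo_bundle F \<longleftrightarrow>
     diffeological_space (base_space F) \<and> diffeological_space (total_space F) \<and>
     subduction (total_space F) (base_space F) (proj F) \<and>
     smooth_fiberwise_operations F \<and>
     (\<forall>x\<in>points (base_space F). diffeological_vector_space (fiber F x))"

definition vector_bundle_with_typical_fiber :: "('a, 'e) vbundle \<Rightarrow> 'f dvspace \<Rightarrow> bool" where
  "vector_bundle_with_typical_fiber F V \<longleftrightarrow>
     vector_pseudo_bundle F \<and> (\<forall>x\<in>points (base_space F). dvs_isomorphic (fiber F x) V)"

definition restrict_bundle :: "('a, 'e) vbundle \<Rightarrow> 'a set \<Rightarrow> ('a, 'e) vbundle" where
  "restrict_bundle F V = F\<lparr> base_space := subset_dspace (base_space F) V,
     total_space := subset_dspace (total_space F) {e. proj F e \<in> V} \<rparr>"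

definition neighborhood_base :: "'a topology \<Rightarrow> 'a \<Rightarrow> 'a set set \<Rightarrow> bool" where
  "neighborhood_base T x \<V> \<longleftrightarrow>
     (\<forall>V\<in>\<V>. V \<subseteq> topspace T \<and> (\<exists>W. openin T W \<and> x \<in> W \<and> W \<subseteq> V)) \<and>
     (\<forall>W. openin T W \<and> x \<in> W \<longrightarrow> (\<exists>V\<in>\<V>. V \<subseteq> W))"

definition F_singularities :: "('a, 'e) vbundle \<Rightarrow> 'a set" where
  "F_singularities F = {x \<in> points (base_space F).
     \<not> (\<exists>\<V>. neighborhood_base (D_topology (base_space F)) x \<V> \<and>
          (\<forall>V\<in>\<V>. vector_bundle_with_typical_fiber (restrict_bundle F V) (fiber F x)))}"

definition isolated_F_singularity :: "('a, 'e) vbundle \<Rightarrow> 'a \<Rightarrow> bool" where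
  "isolated_F_singularity F x \<longleftrightarrow> x \<in> F_singularities F \<and>
     openin (subtopology (D_topology (base_space F)) (F_singularities F)) {x}"

text \<open>
  \<open>\<F>\<close> is a collection of pairwise non-isomorphic fibers of \<open>F\<close> that represents every
  isomorphism class of fibers.
\<close>

definition fiber_collection :: "('a, 'e) vbundle \<Rightarrow> 'e dvspace set \<Rightarrow> bool" where
  "fiber_collection F \<F> \<longleftrightarrow>
     \<F> \<subseteq> fiber F ` points (base_space F) \<and>
     (\<forall>V\<in>\<F>. \<forall>W\<in>\<F>. dvs_isomorphic V W \<longrightarrow> V = W) \<and>
     (\<forall>x\<in>points (base_space F). \<exists>V\<in>\<F>. dvs_isomorphic (fiber F x) V)"

definition fiber_locus :: "('a, 'e) vbundle \<Rightarrow> 'e dvspace \<Rightarrow> 'a set" where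
  "fiber_locus F V = {x \<in> points (base_space F). dvs_isomorphic (fiber F x) V}"


section \<open>Differential 1-forms and the cotangent space\<close>

text \<open>
  A covector on the \<open>n\<close>-dimensional space is given by its \<open>n\<close> coefficients, hence again as an
  element of \<open>Euc n\<close>, and a 1-form on an open set as a smooth \<open>Euc n\<close>-valued function.
\<close>

definition pullback_form :: "nat \<Rightarrow> nat \<Rightarrow> (euc \<Rightarrow> euc) \<Rightarrow> (euc \<Rightarrow> euc) \<Rightarrow> euc \<Rightarrow> euc" where
  "pullback_form m n g a w =
     (\<lambda>j. if j < m then \<Sum>i<n. a (g w) i * partial j (\<lambda>y. g y i) w else 0)"

type_synonym 'a form = "'a plot \<Rightarrow> euc \<Rightarrow> euc"

definition one_forms :: "'a dspace \<Rightarrow> 'a form set" where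
  "one_forms X = {\<alpha> \<in> extensional (plots X).
     (\<forall>(n, U, p)\<in>plots X. (n, U, \<alpha> (n, U, p)) \<in> plots (euclidean_dspace n)) \<and>
     (\<forall>(n, U, p)\<in>plots X. \<forall>m V g. openin (Euclidean_space m) V \<and> smooth_euc m V n U g \<longrightarrow>
        (\<forall>w\<in>V. \<alpha> (m, V, compose V p g) w = pullback_form m n g (\<alpha> (n, U, p)) w))}"

definition one_forms_dspace :: "'a dspace \<Rightarrow> 'a form dspace" where
  "one_forms_dspace X = \<lparr> points = one_forms X,
     plots = {(k, T, A). openin (Euclidean_space k) T \<and> A \<in> T \<rightarrow>\<^sub>E one_forms X \<and>
       (\<forall>(n, U, p)\<in>plots X.
          smooth_map (prod_dspace (subset_dspace (euclidean_dspace k) T)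
                                  (subset_dspace (euclidean_dspace n) U))
            (euclidean_dspace n) (\<lambda>(t, u). A t (n, U, p) u))} \<rparr>"

definition form_add :: "'a dspace \<Rightarrow> 'a form \<Rightarrow> 'a form \<Rightarrow> 'a form" where
  "form_add X \<alpha> \<beta> = (\<lambda>(n, U, p)\<in>plots X. \<lambda>u\<in>U. \<alpha> (n, U, p) u + \<beta> (n, U, p) u)"

definition form_scale :: "'a dspace \<Rightarrow> real \<Rightarrow> 'a form \<Rightarrow> 'a form" where
  "form_scale X r \<alpha> = (\<lambda>(n, U, p)\<in>plots X. \<lambda>u\<in>U. \<lambda>i. r * \<alpha> (n, U, p) u i)"

definition form_zero :: "'a dspace \<Rightarrow> 'a form" where
  "form_zero X = (\<lambda>(n, U, p)\<in>plots X. \<lambda>u\<in>U. 0)"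

definition cotangent_rel :: "'a dspace \<Rightarrow> (('a \<times> 'a form) \<times> ('a \<times> 'a form)) set" where
  "cotangent_rel X = {((x, \<alpha>), (y, \<beta>)). x \<in> points X \<and> y = x \<and> \<alpha> \<in> one_forms X \<and> \<beta> \<in> one_forms X \<and>
     (\<forall>(n, U, p)\<in>plots X. 0 \<in> U \<and> p 0 = x \<longrightarrow> \<alpha> (n, U, p) 0 = \<beta> (n, U, p) 0)}"

text \<open>
  The operations on classes are formed from all representatives; since the operations respect
  the relation, the image under the relation is a single class.
\<close>

definition cotangent_bundle :: "'a dspace \<Rightarrow> ('a, ('a \<times> 'a form) set) vbundle" where
  "cotangent_bundle X = \<lparr> base_space = X,
     total_space = quotient_dspace (prod_dspace X (one_forms_dspace X)) (cotangent_rel X),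
     proj = (\<lambda>c. the_elem (fst ` c)),
     fadd = (\<lambda>c d. cotangent_rel X `` {(x, form_add X \<alpha> \<beta>) | x \<alpha> \<beta>. (x, \<alpha>) \<in> c \<and> (x, \<beta>) \<in> d}),
     fscale = (\<lambda>r c. cotangent_rel X `` {(x, form_scale X r \<alpha>) | x \<alpha>. (x, \<alpha>) \<in> c}),
     fzero = (\<lambda>x. cotangent_rel X `` {(x, form_zero X)}) \<rparr>"


section \<open>The internal tangent space\<close>

definition centered_plots :: "'a dspace \<Rightarrow> 'a \<Rightarrow> 'a plot set" where
  "centered_plots X x = {(n, U, p)\<in>plots X. connectedin (Euclidean_space n) U \<and> 0 \<in> U \<and> p 0 = x}"

text \<open>
  The colimit of the vector spaces \<open>Euc n\<close>, indexed by the plots centered at \<open>x\<close>, is the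
  direct sum of these spaces (finitely supported families) modulo the span of the differences
  between \<open>v\<close> in the summand of a plot and its image under an arrow in the summand of the target.
\<close>

type_synonym 'a tsum = "'a plot \<Rightarrow> euc"

definition tsum_scale :: "real \<Rightarrow> 'a tsum \<Rightarrow> 'a tsum" where
  "tsum_scale r \<xi> = (\<lambda>q i. r * \<xi> q i)"

definition tsums :: "'a dspace \<Rightarrow> 'a \<Rightarrow> 'a tsum set" where
  "tsums X x = {\<xi>. (\<forall>(n, U, p)\<in>centered_plots X x. \<xi> (n, U, p) \<in> Euc n) \<and>
     (\<forall>q. q \<notin> centered_plots X x \<longrightarrow> \<xi> q = 0) \<and> finite {q. \<xi> q \<noteq> 0}}"

definition tsum_inj :: "'a plot \<Rightarrow> euc \<Rightarrow> 'a tsum" where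
  "tsum_inj q v = (\<lambda>q'. if q' = q then v else 0)"

text \<open>
  An arrow between centered plots is represented by a smooth map \<open>g\<close> on an open neighbourhood
  \<open>W\<close> of 0; only its differential at 0, hence only its germ, matters.
\<close>

definition arrow_representative :: "'a plot \<Rightarrow> 'a plot \<Rightarrow> euc set \<Rightarrow> (euc \<Rightarrow> euc) \<Rightarrow> bool" where
  "arrow_representative = (\<lambda>(n, U, p) (m, U', p') W g.
     openin (Euclidean_space n) W \<and> 0 \<in> W \<and> W \<subseteq> U \<and> smooth_euc n W m U' g \<and> g 0 = 0 \<and>
     (\<forall>w\<in>W. p w = p' (g w)))"

definition arrow_relations :: "'a dspace \<Rightarrow> 'a \<Rightarrow> 'a tsum set" where
  "arrow_relations X x = {tsum_inj q v - tsum_inj q' (differential (fst q) (fst q') g 0 v) | q q' W g v.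
     q \<in> centered_plots X x \<and> q' \<in> centered_plots X x \<and> arrow_representative q q' W g \<and>
     v \<in> Euc (fst q)}"

definition tangent_rel :: "'a dspace \<Rightarrow> 'a \<Rightarrow> ('a tsum \<times> 'a tsum) set" where
  "tangent_rel X x = {(\<xi>, \<eta>). \<xi> \<in> tsums X x \<and> \<eta> \<in> tsums X x \<and>
     \<xi> - \<eta> \<in> module.span tsum_scale (arrow_relations X x)}"

definition internal_tangent_points :: "'a dspace \<Rightarrow> ('a \<times> 'a tsum set) set" where
  "internal_tangent_points X = (SIGMA x : points X. tsums X x // tangent_rel X x)"

text \<open>
  The natural map \<open>TU \<rightarrow> \<^sup>iTX\<close> of a plot \<open>p\<close> on \<open>U\<close> sends \<open>(u, v)\<close> to the class of \<open>v\<close> at the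
  plot \<open>w \<mapsto> p (u + w)\<close>, restricted to a connected neighbourhood of 0.  The choice of the
  connected neighbourhood is immaterial; we take the connected component.
\<close>

definition recenter_plot :: "'a plot \<Rightarrow> euc \<Rightarrow> 'a plot" where
  "recenter_plot = (\<lambda>(n, U, p) u.
     let W = connected_component_of_set (subtopology (Euclidean_space n) {w. u + w \<in> U}) 0
     in (n, W, \<lambda>w\<in>W. p (u + w)))"

definition natural_map :: "'a dspace \<Rightarrow> 'a plot \<Rightarrow> euc \<times> euc \<Rightarrow> 'a \<times> 'a tsum set" where
  "natural_map X = (\<lambda>(n, U, p) (u, v).
     (p u, tangent_rel X (p u) `` {tsum_inj (recenter_plot (n, U, p) u) v}))"

definition internal_tangent_with :: "'a dspace \<Rightarrow> ('a \<times> 'a tsum set) plot set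
    \<Rightarrow> ('a, 'a \<times> 'a tsum set) vbundle" where
  "internal_tangent_with X D = \<lparr> base_space = X,
     total_space = \<lparr> points = internal_tangent_points X, plots = D \<rparr>,
     proj = fst,
     fadd = (\<lambda>(x, c) (y, d). (x, tangent_rel X x `` {\<xi> + \<eta> | \<xi> \<eta>. \<xi> \<in> c \<and> \<eta> \<in> d})),
     fscale = (\<lambda>r (x, c). (x, tangent_rel X x `` {tsum_scale r \<xi> | \<xi>. \<xi> \<in> c})),
     fzero = (\<lambda>x. (x, tangent_rel X x `` {0})) \<rparr>"

definition admissible_tangent_diffeology :: "'a dspace \<Rightarrow> ('a \<times> 'a tsum set) plot set \<Rightarrow> bool" where
  "admissible_tangent_diffeology X D \<longleftrightarrow>
     (let F = internal_tangent_with X D in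
       diffeological_space (total_space F) \<and>
       (\<forall>(n, U, p)\<in>plots X.
          smooth_map (prod_dspace (subset_dspace (euclidean_dspace n) U) (euclidean_dspace n))
            (total_space F) (natural_map X (n, U, p))) \<and>
       smooth_fiberwise_operations F \<and>
       smooth_map X (total_space F) (fzero F))"

text \<open>
  All conditions in \<open>admissible_tangent_diffeology\<close> are stable under intersection, and they
  hold for the indiscrete diffeology, so the intersection is the smallest such diffeology.
\<close>

definition internal_tangent_bundle :: "'a dspace \<Rightarrow> ('a, 'a \<times> 'a tsum set) vbundle" where
  "internal_tangent_bundle X =
     internal_tangent_with X (\<Inter>{D. admissible_tangent_diffeology X D})"

end

theory Submission
  imports Defs
begin

text \<open>
  A diffeomorphism \<open>f\<close> of \<open>X\<close> acts on \<open>T\<^sup>*X\<close> (by pulling back forms along \<open>f\<close>'s inverse) and on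
  the internal tangent space (by composing plots with \<open>f\<close>), and this lift of \<open>f\<close> is an isomorphism
  of pseudo-bundles. Hence \<open>f\<close> preserves the isomorphism type of fibers and the set of
  \<open>F\<close>-singularities. Along a smooth homotopy \<open>\<gamma>\<close> from the identity to \<open>\<phi>\<close> the path
  \<open>t \<mapsto> \<gamma> t x\<close> therefore joins \<open>x\<close> to \<open>\<phi> x\<close> inside the locus of \<open>x\<close>. If \<open>x\<close> is an isolated
  singularity, then so is every \<open>\<gamma> t x\<close>, each \<open>\<gamma> t\<close> being a homeomorphism for the D-topology;
  the path is then a connected set of isolated points, hence constant. Arguing with all points
  of the path, rather than with \<open>x\<close> alone, is what makes this work for a D-topology that
  is not T1.
\<close>

section \<open>Isomorphisms of diffeological spaces\<close>

text \<open>The two bundles differ in how their lifts are seen to be smooth. A plot of the cotangent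
  space lifts locally to pairs of a point and a form, so smoothness is checked on representatives.
  The internal tangent space offers no such description: its diffeology is an intersection, and a
  plot of it is known only by belonging to every admissible diffeology. An arbitrary admissible
  diffeology is therefore pulled back along the lift, and the result is verified to be admissible
  again. The argument also meets subsets without any openness: the loci, and the members of a
  neighborhood base. The transport lemmas therefore work with \<open>proper_plots\<close>, the first
  clause of \<open>diffeological_space\<close>, which passes at once to subsets, products and
  quotients. The remaining axioms, and the property of being a vector pseudo-bundle, are carried
  across isomorphisms from one side to the other.\<close>

definition proper_plots :: "'a dspace \<Rightarrow> bool" where
  "proper_plots X \<longleftrightarrow>
     (\<forall>(n, U, p)\<in>plots X. openin (Euclidean_space n) U \<and> p \<in> U \<rightarrow>\<^sub>E points X)"

lemma Ball_triple: "(\<forall>(n, U, p)\<in>S. P n U p) \<longleftrightarrow> (\<forall>n U p. (n, U, p) \<in> S \<longrightarrow> P n U p)"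
  by auto

lemmas proper_plots_iff = proper_plots_def[unfolded Ball_triple]

lemma proper_plotsD:
  assumes "proper_plots X" "(n, U, p) \<in> plots X"
  shows "openin (Euclidean_space n) U" "p \<in> U \<rightarrow>\<^sub>E points X" "p \<in> extensional U"
    "\<And>u. u \<in> U \<Longrightarrow> p u \<in> points X"
proof -
  show "openin (Euclidean_space n) U" and p: "p \<in> U \<rightarrow>\<^sub>E points X"
    using assms unfolding proper_plots_iff by blast+
  show "p \<in> extensional U" "\<And>u. u \<in> U \<Longrightarrow> p u \<in> points X"
    using p by (auto simp: PiE_def)
qed

lemmas diffeological_space_iff = diffeological_space_def[unfolded Ball_triple]

lemma diffeological_imp_proper: "diffeological_space X \<Longrightarrow> proper_plots X"
  unfolding diffeological_space_def proper_plots_def by (elim conjE)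

lemma diffeological_constant:
  assumes "diffeological_space X" "x \<in> points X" "openin (Euclidean_space n) U"
  shows "(n, U, \<lambda>u\<in>U. x) \<in> plots X"
proof -
  have "\<forall>n U. \<forall>x\<in>points X. openin (Euclidean_space n) U \<longrightarrow> (n, U, \<lambda>u\<in>U. x) \<in> plots X"
    using assms(1) unfolding diffeological_space_def by (elim conjE)
  then show ?thesis using assms(2,3) by blast
qed

lemma diffeological_reparametrize:
  assumes "diffeological_space X" "(n, U, p) \<in> plots X"
    "openin (Euclidean_space m) V" "smooth_euc m V n U g"
  shows "(m, V, compose V p g) \<in> plots X"
proof -
  have "\<forall>n U p. (n, U, p) \<in> plots X \<longrightarrow> (\<forall>m V g. openin (Euclidean_space m) V \<and> smooth_euc m V n U g
        \<longrightarrow> (m, V, compose V p g) \<in> plots X)"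
    using assms(1) unfolding diffeological_space_iff by (elim conjE)
  then show ?thesis using assms(2-4) by simp
qed

lemma diffeological_local:
  assumes "diffeological_space X" "openin (Euclidean_space n) U" "p \<in> U \<rightarrow>\<^sub>E points X"
    "\<And>u. u \<in> U \<Longrightarrow> \<exists>V. openin (Euclidean_space n) V \<and> u \<in> V \<and> V \<subseteq> U \<and> (n, V, restrict p V) \<in> plots X"
  shows "(n, U, p) \<in> plots X"
proof -
  have "\<forall>n U p. openin (Euclidean_space n) U \<and> p \<in> U \<rightarrow>\<^sub>E points X \<and>
        (\<forall>u\<in>U. \<exists>V. openin (Euclidean_space n) V \<and> u \<in> V \<and> V \<subseteq> U \<and> (n, V, restrict p V) \<in> plots X)
        \<longrightarrow> (n, U, p) \<in> plots X"
    using assms(1) unfolding diffeological_space_iff by (elim conjE)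
  then show ?thesis using assms(2-4) by simp
qed

lemma smooth_mapI:
  assumes "\<And>x. x \<in> points X \<Longrightarrow> f x \<in> points Y"
    and "\<And>n U p. (n, U, p) \<in> plots X \<Longrightarrow> (n, U, compose U f p) \<in> plots Y"
  shows "smooth_map X Y f"
  using assms unfolding smooth_map_def by auto

lemma smooth_map_points: "smooth_map X Y f \<Longrightarrow> x \<in> points X \<Longrightarrow> f x \<in> points Y"
  unfolding smooth_map_def by auto

lemma smooth_map_plots:
  "smooth_map X Y f \<Longrightarrow> (n, U, p) \<in> plots X \<Longrightarrow> (n, U, compose U f p) \<in> plots Y"
  unfolding smooth_map_def by auto

lemma compose_compose: "compose U f (compose U g p) = compose U (\<lambda>x. f (g x)) p"
  by (auto simp: compose_def)

lemma smooth_map_comp: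
  assumes "smooth_map X Y f" "smooth_map Y Z g"
  shows "smooth_map X Z (\<lambda>x. g (f x))"
proof (rule smooth_mapI)
  fix n U p assume "(n, U, p) \<in> plots X"
  then show "(n, U, compose U (\<lambda>x. g (f x)) p) \<in> plots Z"
    using smooth_map_plots[OF assms(2) smooth_map_plots[OF assms(1)]] by (simp add: compose_compose)
qed (use assms in \<open>auto intro: smooth_map_points\<close>)

lemma compose_cong_on:
  assumes "\<And>u. u \<in> U \<Longrightarrow> f (p u) = g (q u)"
  shows "compose U f p = compose U g q"
  using assms by (auto simp: compose_def)

lemma compose_id_on:
  assumes "p \<in> extensional U" "\<And>u. u \<in> U \<Longrightarrow> f (p u) = p u"
  shows "compose U f p = p"
  using assms by (auto simp: compose_def extensional_def)

lemma smooth_map_cong: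
  assumes "proper_plots X" "smooth_map X Y f" "\<And>x. x \<in> points X \<Longrightarrow> f x = g x"
  shows "smooth_map X Y g"
proof (rule smooth_mapI)
  show "g x \<in> points Y" if "x \<in> points X" for x
    using smooth_map_points[OF assms(2) that] assms(3)[OF that] by simp
next
  fix n U p assume p: "(n, U, p) \<in> plots X"
  have "compose U f p = compose U g p"
    by (rule compose_cong_on) (rule assms(3)[OF proper_plotsD(4)[OF assms(1) p]])
  then show "(n, U, compose U g p) \<in> plots Y" using smooth_map_plots[OF assms(2) p] by simp
qed

text \<open>The inverse is part of the data and both maps are constrained on points only. This makes
  the notion symmetric and spares the transport lemmas any reasoning about
  \<open>inv_into\<close>.\<close>

definition dspace_iso :: "'a dspace \<Rightarrow> 'b dspace \<Rightarrow> ('a \<Rightarrow> 'b) \<Rightarrow> ('b \<Rightarrow> 'a) \<Rightarrow> bool" where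
  "dspace_iso A B f g \<longleftrightarrow> smooth_map A B f \<and> smooth_map B A g \<and>
     (\<forall>a\<in>points A. g (f a) = a) \<and> (\<forall>b\<in>points B. f (g b) = b)"

lemma dspace_isoD:
  assumes "dspace_iso A B f g"
  shows "smooth_map A B f" "smooth_map B A g"
    "\<And>a. a \<in> points A \<Longrightarrow> g (f a) = a" "\<And>b. b \<in> points B \<Longrightarrow> f (g b) = b"
    "\<And>a. a \<in> points A \<Longrightarrow> f a \<in> points B" "\<And>b. b \<in> points B \<Longrightarrow> g b \<in> points A"
    "\<And>n U p. (n, U, p) \<in> plots A \<Longrightarrow> (n, U, compose U f p) \<in> plots B"
    "\<And>n U q. (n, U, q) \<in> plots B \<Longrightarrow> (n, U, compose U g q) \<in> plots A"
  using assms unfolding dspace_iso_def smooth_map_def by auto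

lemma dspace_iso_sym: "dspace_iso A B f g \<Longrightarrow> dspace_iso B A g f"
  unfolding dspace_iso_def by auto

lemma dspace_iso_bij_betw:
  assumes "dspace_iso A B f g"
  shows "bij_betw f (points A) (points B)"
  by (rule bij_betw_byWitness[where f' = g]) (use dspace_isoD[OF assms] in auto)

lemma dspace_iso_refl: "proper_plots A \<Longrightarrow> dspace_iso A A (\<lambda>x. x) (\<lambda>x. x)"
proof -
  assume A: "proper_plots A"
  have "smooth_map A A (\<lambda>x. x)"
    by (rule smooth_mapI) (auto simp: compose_id_on proper_plotsD[OF A])
  then show ?thesis by (simp add: dspace_iso_def)
qed

text \<open>On the points of \<open>B\<close> the map \<open>h'\<close> agrees with the composite of
  \<open>g\<close>, \<open>h\<close> and \<open>f'\<close>, which is smooth. Values off the points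
  are invisible to the plots of \<open>B\<close>.\<close>

lemma smooth_map_transfer:
  assumes "dspace_iso A B f g" "dspace_iso A' B' f' g'" "proper_plots B" "smooth_map A A' h"
    and eq: "\<And>a. a \<in> points A \<Longrightarrow> h' (f a) = f' (h a)"
  shows "smooth_map B B' h'"
proof -
  have "smooth_map B B' (\<lambda>b. f' (h (g b)))"
    by (rule smooth_map_comp[OF smooth_map_comp[OF dspace_isoD(2)[OF assms(1)] assms(4)]
          dspace_isoD(1)[OF assms(2)]])
  then show ?thesis
  proof (rule smooth_map_cong[OF assms(3)])
    fix b assume "b \<in> points B"
    then show "f' (h (g b)) = h' b"
      using eq[of "g b"] dspace_isoD(4,6)[OF assms(1)] by simp
  qed
qed

text \<open>A map \<open>q\<close> into the points of \<open>B\<close> is a plot as soon as its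
  composite with \<open>g\<close> is a plot of \<open>A\<close>, because \<open>f\<close> recovers
  \<open>q\<close> from that composite (\<open>plotI\<close>). Each closure axiom for
  \<open>B\<close> is thereby read off in \<open>A\<close>.\<close>

lemma diffeological_space_transfer:
  assumes i: "dspace_iso A B f g" and A: "diffeological_space A" and B: "proper_plots B"
  shows "diffeological_space B"
proof -
  note I = dspace_isoD[OF i]
  have fg: "compose U f (compose U g q) = q" if "q \<in> U \<rightarrow>\<^sub>E points B" for U :: "euc set" and q
    unfolding compose_compose using that I(4) by (intro compose_id_on) (auto simp: PiE_def)
  have plotI: "(n, U, q) \<in> plots B"
    if "q \<in> U \<rightarrow>\<^sub>E points B" "(n, U, compose U g q) \<in> plots A" for n U q
    using I(7)[OF that(2)] fg[OF that(1)] by simp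
  show ?thesis
    unfolding diffeological_space_iff
  proof (intro conjI allI ballI impI, goal_cases)
    case (1 n U q)
    then show ?case by (rule proper_plotsD[OF B])
  next
    case (2 n U q)
    then show ?case by (rule proper_plotsD[OF B])
  next
    case (3 n U x)
    have "compose U g (\<lambda>u\<in>U. x) = (\<lambda>u\<in>U. g x)" by (auto simp: compose_def)
    then show ?case
      using 3 diffeological_constant[OF A I(6)] by (intro plotI) auto
  next
    case (4 n U p m V h)
    note P = proper_plotsD[OF B 4(1)]
    show ?case
    proof (rule plotI)
      have hV: "h v \<in> U" if "v \<in> V" for v using 4(2) that by (auto simp: smooth_euc_def)
      then show "compose V p h \<in> V \<rightarrow>\<^sub>E points B" using P(4) by (auto simp: compose_def)
      have "compose V g (compose V p h) = compose V (compose U g p) h"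
        using hV by (auto simp: compose_def)
      then show "(m, V, compose V g (compose V p h)) \<in> plots A"
        using diffeological_reparametrize[OF A I(8)[OF 4(1)]] 4(2) by simp
    qed
  next
    case (5 n U p)
    show ?case
    proof (rule plotI)
      show "p \<in> U \<rightarrow>\<^sub>E points B" using 5 by blast
      show "(n, U, compose U g p) \<in> plots A"
      proof (rule diffeological_local[OF A])
        show "compose U g p \<in> U \<rightarrow>\<^sub>E points A" using 5 I(6) by (auto simp: compose_def PiE_iff)
        fix u assume "u \<in> U"
        then obtain V where V: "openin (Euclidean_space n) V" "u \<in> V" "V \<subseteq> U"
          "(n, V, restrict p V) \<in> plots B" using 5 by blast
        have "compose V g (restrict p V) = restrict (compose U g p) V"
          by (rule ext) (use V(3) in \<open>auto simp: compose_def restrict_def\<close>)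
        then show "\<exists>V. openin (Euclidean_space n) V \<and> u \<in> V \<and> V \<subseteq> U \<and>
            (n, V, restrict (compose U g p) V) \<in> plots A"
          using V I(8)[OF V(4)] by auto
      qed (use 5 in blast)
    qed
  qed
qed

section \<open>Subspaces, products and subductions\<close>

lemma proper_subset_dspace: "proper_plots X \<Longrightarrow> proper_plots (subset_dspace X S)"
  unfolding proper_plots_def subset_dspace_def by fastforce

lemma proper_prod_dspace:
  assumes "proper_plots X" "proper_plots Y"
  shows "proper_plots (prod_dspace X Y)"
  unfolding proper_plots_def
proof (intro ballI, clarify, intro conjI)
  fix n U p assume p: "(n, U, p) \<in> plots (prod_dspace X Y)"
  then have 1: "(n, U, compose U fst p) \<in> plots X" and 2: "(n, U, compose U snd p) \<in> plots Y"
    and e: "p \<in> extensional U"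
    by (auto simp: prod_dspace_def)
  show "openin (Euclidean_space n) U" using proper_plotsD(1)[OF assms(1) 1] .
  have "fst (p u) \<in> points X" "snd (p u) \<in> points Y" if "u \<in> U" for u
    using proper_plotsD(4)[OF assms(1) 1 that] proper_plotsD(4)[OF assms(2) 2 that] that
    by (auto simp: compose_def)
  then show "p \<in> U \<rightarrow>\<^sub>E points (prod_dspace X Y)"
    using e by (auto simp: prod_dspace_def PiE_iff mem_Times_iff)
qed

lemma points_subset_dspace [simp]: "points (subset_dspace X S) = points X \<inter> S"
  by (simp add: subset_dspace_def)

lemma points_prod_dspace [simp]: "points (prod_dspace X Y) = points X \<times> points Y"
  by (simp add: prod_dspace_def)

lemma smooth_map_subset:
  assumes "proper_plots A" "smooth_map A B f" "\<And>a. a \<in> points A \<Longrightarrow> a \<in> S \<Longrightarrow> f a \<in> T"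
  shows "smooth_map (subset_dspace A S) (subset_dspace B T) f"
proof (rule smooth_mapI)
  fix n U p assume "(n, U, p) \<in> plots (subset_dspace A S)"
  then have p: "(n, U, p) \<in> plots A" "p ` U \<subseteq> S" by (auto simp: subset_dspace_def)
  then show "(n, U, compose U f p) \<in> plots (subset_dspace B T)"
    using smooth_map_plots[OF assms(2) p(1)] proper_plotsD(4)[OF assms(1) p(1)] assms(3)
    by (auto simp: subset_dspace_def compose_def)
qed (use assms smooth_map_points[OF assms(2)] in auto)

lemma dspace_iso_subset:
  assumes i: "dspace_iso A B f g" and "proper_plots A" "proper_plots B"
    and ST: "\<And>a. a \<in> points A \<Longrightarrow> f a \<in> T \<longleftrightarrow> a \<in> S"
  shows "dspace_iso (subset_dspace A S) (subset_dspace B T) f g"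
proof -
  have "g b \<in> S" if "b \<in> points B" "b \<in> T" for b
    using ST[of "g b"] dspace_isoD[OF i] that by auto
  then show ?thesis
    using dspace_isoD[OF i] ST assms(2,3) unfolding dspace_iso_def
    by (auto intro!: smooth_map_subset)
qed

lemma smooth_map_prod:
  assumes "smooth_map A B f" "smooth_map A' B' f'"
  shows "smooth_map (prod_dspace A A') (prod_dspace B B') (map_prod f f')"
proof (rule smooth_mapI)
  fix n U p assume p: "(n, U, p) \<in> plots (prod_dspace A A')"
  have "compose U fst (compose U (map_prod f f') p) = compose U f (compose U fst p)"
    "compose U snd (compose U (map_prod f f') p) = compose U f' (compose U snd p)"
    by (auto simp: compose_def)
  then show "(n, U, compose U (map_prod f f') p) \<in> plots (prod_dspace B B')"
    using p smooth_map_plots[OF assms(1)] smooth_map_plots[OF assms(2)]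
    by (auto simp: prod_dspace_def)
qed (use assms in \<open>auto intro: smooth_map_points\<close>)

lemma dspace_iso_prod:
  assumes "dspace_iso A B f g" "dspace_iso A' B' f' g'"
  shows "dspace_iso (prod_dspace A A') (prod_dspace B B') (map_prod f f') (map_prod g g')"
  using assms unfolding dspace_iso_def by (auto intro!: smooth_map_prod)

lemma subset_subset_dspace:
  "subset_dspace (subset_dspace X S) T = subset_dspace X (S \<inter> T)"
  by (auto simp: subset_dspace_def)

lemma proper_real_dspace: "proper_plots real_dspace"
  by (auto simp: proper_plots_def real_dspace_def PiE_iff)

lemma subduction_lift:
  assumes "subduction X Y f" "(n, U, q) \<in> plots Y" "u \<in> U"
  obtains V p where "u \<in> V" "V \<subseteq> U" "(n, V, p) \<in> plots X" "\<And>v. v \<in> V \<Longrightarrow> q v = f (p v)"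
proof -
  have "\<forall>n U q. (n, U, q) \<in> plots Y \<longrightarrow> (\<forall>u\<in>U. \<exists>V p. u \<in> V \<and> V \<subseteq> U \<and> (n, V, p) \<in> plots X \<and>
      (\<forall>v\<in>V. q v = f (p v)))"
    using assms(1) unfolding subduction_def Ball_triple by (elim conjE)
  then have "\<forall>u\<in>U. \<exists>V p. u \<in> V \<and> V \<subseteq> U \<and> (n, V, p) \<in> plots X \<and> (\<forall>v\<in>V. q v = f (p v))"
    using assms(2) by simp
  then show ?thesis using assms(3) that by blast
qed

text \<open>A plot of \<open>B'\<close> is sent by \<open>g'\<close> to a plot of \<open>A'\<close>,
  lifted locally to \<open>A\<close> there, and the lift is pushed forward by
  \<open>f\<close>.\<close>

lemma subduction_transfer:
  assumes i: "dspace_iso A B f g" "dspace_iso A' B' f' g'" and pr: "proper_plots B" "proper_plots A'" "proper_plots B'"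
    and h: "subduction A A' h"
    and eq: "\<And>a. a \<in> points A \<Longrightarrow> h' (f a) = f' (h a)"
    and A: "proper_plots A"
  shows "subduction B B' h'"
  unfolding subduction_def
proof (intro conjI ballI, goal_cases)
  have hs: "smooth_map A A' h" and hp: "h ` points A = points A'"
    using h by (auto simp: subduction_def)
  case 1
  show ?case using smooth_map_transfer[OF i pr(1) hs eq] .
  case 2
  have "h' ` points B = h' ` f ` points A"
    using dspace_iso_bij_betw[OF i(1)] by (simp add: bij_betw_def)
  also have "\<dots> = f' ` h ` points A" using eq by (auto simp: image_image)
  also have "\<dots> = points B'"
    using dspace_iso_bij_betw[OF i(2)] hp by (simp add: bij_betw_def)
  finally show ?case .
next
  case (3 q')
  obtain n U q where q': "q' = (n, U, q)" by (cases q')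
  with 3 have q: "(n, U, q) \<in> plots B'" by simp
  have "\<exists>V p. u \<in> V \<and> V \<subseteq> U \<and> (n, V, p) \<in> plots B \<and> (\<forall>v\<in>V. q v = h' (p v))" if u: "u \<in> U" for u
  proof -
    obtain V p where V: "u \<in> V" "V \<subseteq> U" "(n, V, p) \<in> plots A"
      "\<And>v. v \<in> V \<Longrightarrow> compose U g' q v = h (p v)"
      by (rule subduction_lift[OF h dspace_isoD(8)[OF i(2) q] u]) blast
    have "q v = h' (compose V f p v)" if "v \<in> V" for v
    proof -
      have "q v = f' (g' (q v))"
        using dspace_isoD(4)[OF i(2)] proper_plotsD(4)[OF pr(3) q] that V(2) by auto
      also have "g' (q v) = h (p v)" using V(4)[OF that] that V(2) by (auto simp: compose_def)
      also have "f' (h (p v)) = h' (f (p v))" using eq proper_plotsD(4)[OF A V(3) that] by simp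
      finally show ?thesis using that by (simp add: compose_def)
    qed
    then show ?thesis using V dspace_isoD(7)[OF i(1) V(3)] by blast
  qed
  then show ?case by (auto simp: q')
qed

text \<open>\<open>dvs_isomorphic\<close> insists on \<open>inv_into\<close> as the inverse;
  bijectivity makes it agree with \<open>g\<close> on the points of \<open>W\<close>.\<close>

lemma dvs_isomorphicI:
  assumes i: "dspace_iso (vspace V) (vspace W) f g" and W: "proper_plots (vspace W)"
    and "\<And>a b. a \<in> points (vspace V) \<Longrightarrow> b \<in> points (vspace V) \<Longrightarrow> f (vadd V a b) = vadd W (f a) (f b)"
    and "\<And>r a. a \<in> points (vspace V) \<Longrightarrow> f (vscale V r a) = vscale W r (f a)"
  shows "dvs_isomorphic V W"
proof -
  note bij = dspace_iso_bij_betw[OF i]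
  have "smooth_map (vspace W) (vspace V) (inv_into (points (vspace V)) f)"
  proof (rule smooth_map_cong[OF W dspace_isoD(2)[OF i]])
    fix b assume "b \<in> points (vspace W)"
    then show "g b = inv_into (points (vspace V)) f b"
      using bij_betw_inv_into_left[OF bij, of "g b"] dspace_isoD(4,6)[OF i] by simp
  qed
  then show ?thesis
    using bij dspace_isoD(1)[OF i] assms(3,4) unfolding dvs_isomorphic_def by blast
qed

lemma dvs_isomorphicE:
  assumes "dvs_isomorphic V W"
  obtains f g where "dspace_iso (vspace V) (vspace W) f g"
    "\<And>a b. a \<in> points (vspace V) \<Longrightarrow> b \<in> points (vspace V) \<Longrightarrow> f (vadd V a b) = vadd W (f a) (f b)"
    "\<And>r a. a \<in> points (vspace V) \<Longrightarrow> f (vscale V r a) = vscale W r (f a)"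
proof -
  obtain f where f: "bij_betw f (points (vspace V)) (points (vspace W))"
    "smooth_map (vspace V) (vspace W) f"
    "smooth_map (vspace W) (vspace V) (inv_into (points (vspace V)) f)"
    "\<forall>a\<in>points (vspace V). \<forall>b\<in>points (vspace V). f (vadd V a b) = vadd W (f a) (f b)"
    "\<forall>r. \<forall>a\<in>points (vspace V). f (vscale V r a) = vscale W r (f a)"
    using assms unfolding dvs_isomorphic_def by blast
  have "dspace_iso (vspace V) (vspace W) f (inv_into (points (vspace V)) f)"
    unfolding dspace_iso_def
    using f bij_betw_inv_into_left[OF f(1)] bij_betw_inv_into_right[OF f(1)] by auto
  then show ?thesis using f that by blast
qed

lemma dspace_iso_comp:
  assumes "dspace_iso A B f g" "dspace_iso B C f' g'"
  shows "dspace_iso A C (\<lambda>x. f' (f x)) (\<lambda>x. g (g' x))"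
  unfolding dspace_iso_def
  using dspace_isoD[OF assms(1)] dspace_isoD[OF assms(2)]
    smooth_map_comp[OF dspace_isoD(1)[OF assms(1)] dspace_isoD(1)[OF assms(2)]]
    smooth_map_comp[OF dspace_isoD(2)[OF assms(2)] dspace_isoD(2)[OF assms(1)]] by simp

lemma dvs_isomorphic_trans:
  assumes "dvs_isomorphic U V" "dvs_isomorphic V W" "proper_plots (vspace W)"
  shows "dvs_isomorphic U W"
proof -
  obtain f g where f: "dspace_iso (vspace U) (vspace V) f g"
    "\<And>a b. a \<in> points (vspace U) \<Longrightarrow> b \<in> points (vspace U) \<Longrightarrow> f (vadd U a b) = vadd V (f a) (f b)"
    "\<And>r a. a \<in> points (vspace U) \<Longrightarrow> f (vscale U r a) = vscale V r (f a)"
    using dvs_isomorphicE[OF assms(1)] by blast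
  obtain f' g' where f': "dspace_iso (vspace V) (vspace W) f' g'"
    "\<And>a b. a \<in> points (vspace V) \<Longrightarrow> b \<in> points (vspace V) \<Longrightarrow> f' (vadd V a b) = vadd W (f' a) (f' b)"
    "\<And>r a. a \<in> points (vspace V) \<Longrightarrow> f' (vscale V r a) = vscale W r (f' a)"
    using dvs_isomorphicE[OF assms(2)] by blast
  show ?thesis
    by (rule dvs_isomorphicI[OF dspace_iso_comp[OF f(1) f'(1)] assms(3)])
      (use f f' dspace_isoD[OF f(1)] in auto)
qed

lemma diffeological_vector_space_transfer:
  assumes V: "diffeological_vector_space V"
    and i: "dspace_iso (vspace V) (vspace W) f g" and W: "proper_plots (vspace W)"
    and add: "\<And>a b. a \<in> points (vspace V) \<Longrightarrow> b \<in> points (vspace V) \<Longrightarrow> f (vadd V a b) = vadd W (f a) (f b)"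
    and scale: "\<And>r a. a \<in> points (vspace V) \<Longrightarrow> f (vscale V r a) = vscale W r (f a)"
    and zero: "f (vzero V) = vzero W"
  shows "diffeological_vector_space W"
proof -
  note V' = V[unfolded diffeological_vector_space_def Let_def]
  let ?S = "points (vspace V)"
  \<comment> \<open>Writing the carrier of \<open>W\<close> as an image turns every quantifier over
    \<open>W\<close> into one over \<open>V\<close>, where \<open>W_add\<close> and
    \<open>W_scale\<close> move \<open>f\<close> outwards and the axioms of \<open>V\<close>
    apply.\<close>
  have img: "points (vspace W) = f ` ?S"
    using dspace_iso_bij_betw[OF i] by (simp add: bij_betw_def)
  have add_in: "vadd V a b \<in> ?S" if "a \<in> ?S" "b \<in> ?S" for a b using V' that by blast
  have scale_in: "vscale V r a \<in> ?S" if "a \<in> ?S" for r a using V' that by blast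
  have z_in: "vzero V \<in> ?S" using V' by blast
  have W_add: "vadd W (f a) (f b) = f (vadd V a b)" if "a \<in> ?S" "b \<in> ?S" for a b
    using add that by simp
  have W_scale: "vscale W r (f a) = f (vscale V r a)" if "a \<in> ?S" for r a
    using scale that by simp
  have ds: "diffeological_space (vspace W)"
    using diffeological_space_transfer[OF i _ W] V' by blast
  have sa: "smooth_map (prod_dspace (vspace W) (vspace W)) (vspace W) (\<lambda>(a, b). vadd W a b)"
  proof (rule smooth_map_transfer[OF dspace_iso_prod[OF i i] i proper_prod_dspace[OF W W]])
    show "smooth_map (prod_dspace (vspace V) (vspace V)) (vspace V) (\<lambda>(a, b). vadd V a b)"
      using V' by blast
  qed (auto simp: add)
  have ss: "smooth_map (prod_dspace real_dspace (vspace W)) (vspace W) (\<lambda>(r, a). vscale W r a)"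
  proof (rule smooth_map_transfer[OF dspace_iso_prod[OF dspace_iso_refl[OF proper_real_dspace] i] i
        proper_prod_dspace[OF proper_real_dspace W]])
    show "smooth_map (prod_dspace real_dspace (vspace V)) (vspace V) (\<lambda>(r, a). vscale V r a)"
      using V' by blast
  qed (auto simp: scale)
  have alg: "\<forall>a\<in>?S. \<forall>b\<in>?S. vadd V a b = vadd V b a"
    "\<forall>a\<in>?S. \<forall>b\<in>?S. \<forall>c\<in>?S. vadd V (vadd V a b) c = vadd V a (vadd V b c)"
    "\<forall>a\<in>?S. vadd V (vzero V) a = a \<and> (\<exists>b\<in>?S. vadd V a b = vzero V)"
    "\<forall>r. \<forall>a\<in>?S. \<forall>b\<in>?S. vscale V r (vadd V a b) = vadd V (vscale V r a) (vscale V r b)"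
    "\<forall>r s. \<forall>a\<in>?S. vscale V (r + s) a = vadd V (vscale V r a) (vscale V s a)"
    "\<forall>r s. \<forall>a\<in>?S. vscale V (r * s) a = vscale V r (vscale V s a)"
    "\<forall>a\<in>?S. vscale V 1 a = a"
    using V' by blast+
  have inverse: "\<exists>b\<in>?S. f (vadd V a b) = f (vzero V)" if "a \<in> ?S" for a
    using alg(3) that by metis
  have comm: "\<forall>a\<in>f ` ?S. \<forall>b\<in>f ` ?S. vadd W a b \<in> f ` ?S \<and> vadd W a b = vadd W b a"
    using alg(1) by (simp add: W_add add_in)
  show ?thesis
    unfolding diffeological_vector_space_def Let_def img
    by (intro conjI ds sa ss comm;
        simp add: W_add W_scale add_in scale_in z_in zero[symmetric] alg(2-7) inverse)
qed

section \<open>Isomorphisms of vector pseudo-bundles\<close>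

text \<open>Additivity is asked only for pairs in a common fiber, the only place where
  \<open>fadd\<close> has a meaning. The zero section is included because \<open>fiber\<close> takes
  its zero vector from it and \<open>diffeological_vector_space\<close> refers to that
  vector.\<close>

definition bundle_iso ::
  "('a, 'e) vbundle \<Rightarrow> ('b, 'f) vbundle \<Rightarrow> ('a \<Rightarrow> 'b) \<Rightarrow> ('b \<Rightarrow> 'a) \<Rightarrow> ('e \<Rightarrow> 'f) \<Rightarrow> ('f \<Rightarrow> 'e) \<Rightarrow> bool"
where
  "bundle_iso F F' f g \<Phi> \<Psi> \<longleftrightarrow>
     proper_plots (base_space F) \<and> proper_plots (base_space F') \<and>
     proper_plots (total_space F) \<and> proper_plots (total_space F') \<and>
     dspace_iso (base_space F) (base_space F') f g \<and>
     dspace_iso (total_space F) (total_space F') \<Phi> \<Psi> \<and>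
     (\<forall>e\<in>points (total_space F). proj F e \<in> points (base_space F) \<and> proj F' (\<Phi> e) = f (proj F e)) \<and>
     (\<forall>a\<in>points (total_space F). \<forall>b\<in>points (total_space F).
        proj F a = proj F b \<longrightarrow> \<Phi> (fadd F a b) = fadd F' (\<Phi> a) (\<Phi> b)) \<and>
     (\<forall>r. \<forall>a\<in>points (total_space F). \<Phi> (fscale F r a) = fscale F' r (\<Phi> a)) \<and>
     (\<forall>x\<in>points (base_space F). \<Phi> (fzero F x) = fzero F' (f x))"

lemma bundle_isoD:
  assumes "bundle_iso F F' f g \<Phi> \<Psi>"
  shows "proper_plots (base_space F)" "proper_plots (base_space F')"
     "proper_plots (total_space F)" "proper_plots (total_space F')"
     "dspace_iso (base_space F) (base_space F') f g"
     "dspace_iso (total_space F) (total_space F') \<Phi> \<Psi>"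
     "\<And>e. e \<in> points (total_space F) \<Longrightarrow> proj F e \<in> points (base_space F)"
     "\<And>e. e \<in> points (total_space F) \<Longrightarrow> proj F' (\<Phi> e) = f (proj F e)"
     "\<And>a b. a \<in> points (total_space F) \<Longrightarrow> b \<in> points (total_space F) \<Longrightarrow>
        proj F a = proj F b \<Longrightarrow> \<Phi> (fadd F a b) = fadd F' (\<Phi> a) (\<Phi> b)"
     "\<And>r a. a \<in> points (total_space F) \<Longrightarrow> \<Phi> (fscale F r a) = fscale F' r (\<Phi> a)"
     "\<And>x. x \<in> points (base_space F) \<Longrightarrow> \<Phi> (fzero F x) = fzero F' (f x)"
  using assms unfolding bundle_iso_def by auto

lemma bundle_iso_inj:
  assumes "bundle_iso F F' f g \<Phi> \<Psi>" "x \<in> points (base_space F)" "y \<in> points (base_space F)"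
  shows "f x = f y \<longleftrightarrow> x = y"
  using dspace_isoD(3)[OF bundle_isoD(5)[OF assms(1)]] assms(2,3) by metis

text \<open>Injectivity of \<open>f\<close> on the base makes the image of \<open>e\<close> lie over
  \<open>f x\<close> exactly when \<open>e\<close> lies over \<open>x\<close>, so the subset
  isomorphism applies.\<close>

lemma bundle_iso_fiber:
  assumes F: "bundle_iso F F' f g \<Phi> \<Psi>" and x: "x \<in> points (base_space F)"
  shows "dspace_iso (vspace (fiber F x)) (vspace (fiber F' (f x))) \<Phi> \<Psi>"
  unfolding fiber_def dvspace.simps
  by (rule dspace_iso_subset)
    (use bundle_isoD[OF F] bundle_iso_inj[OF F] x in auto)

lemma proper_fiber: "proper_plots (total_space F) \<Longrightarrow> proper_plots (vspace (fiber F x))"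
  by (simp add: fiber_def proper_subset_dspace)

lemma bundle_iso_fibers_isomorphic:
  assumes F: "bundle_iso F F' f g \<Phi> \<Psi>" and x: "x \<in> points (base_space F)"
  shows "dvs_isomorphic (fiber F x) (fiber F' (f x))"
  by (rule dvs_isomorphicI[OF bundle_iso_fiber[OF F x] proper_fiber[OF bundle_isoD(4)[OF F]]])
    (use bundle_isoD[OF F] in \<open>auto simp: fiber_def\<close>)

lemma smooth_fiberwise_operations_transfer:
  assumes F: "bundle_iso F F' f g \<Phi> \<Psi>" and s: "smooth_fiberwise_operations F"
  shows "smooth_fiberwise_operations F'"
  unfolding smooth_fiberwise_operations_def
proof
  note I = bundle_isoD[OF F]
  let ?E = "total_space F" and ?E' = "total_space F'"
  \<comment> \<open>The two fiber products correspond because \<open>f\<close> is injective: two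
    vectors lie over one point exactly when their images do.\<close>
  have i: "dspace_iso (subset_dspace (prod_dspace ?E ?E) {(a, b). proj F a = proj F b})
      (subset_dspace (prod_dspace ?E' ?E') {(a, b). proj F' a = proj F' b})
      (map_prod \<Phi> \<Phi>) (map_prod \<Psi> \<Psi>)"
    by (rule dspace_iso_subset[OF dspace_iso_prod[OF I(6) I(6)]])
      (use I bundle_iso_inj[OF F] in \<open>auto simp: proper_prod_dspace\<close>)
  show "smooth_map (subset_dspace (prod_dspace ?E' ?E') {(a, b). proj F' a = proj F' b})
       ?E' (\<lambda>(a, b). fadd F' a b)"
    by (rule smooth_map_transfer[OF i I(6), where h = "\<lambda>(a, b). fadd F a b"])
      (use I s in \<open>auto simp: proper_prod_dspace proper_subset_dspace smooth_fiberwise_operations_def\<close>)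
  show "smooth_map (prod_dspace real_dspace ?E') ?E' (\<lambda>(r, a). fscale F' r a)"
    by (rule smooth_map_transfer[OF dspace_iso_prod[OF dspace_iso_refl[OF proper_real_dspace] I(6)] I(6),
          where h = "\<lambda>(r, a). fscale F r a"])
      (use I s in \<open>auto simp: proper_prod_dspace proper_real_dspace smooth_fiberwise_operations_def\<close>)
qed

lemma vector_pseudo_bundle_transfer:
  assumes F: "bundle_iso F F' f g \<Phi> \<Psi>" and v: "vector_pseudo_bundle F"
  shows "vector_pseudo_bundle F'"
proof -
  note I = bundle_isoD[OF F]
  have fib: "diffeological_vector_space (fiber F' y)" if y: "y \<in> points (base_space F')" for y
  proof -
    have gy: "g y \<in> points (base_space F)" "f (g y) = y"
      using dspace_isoD[OF I(5)] y by auto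
    show ?thesis
      by (rule diffeological_vector_space_transfer[where V = "fiber F (g y)" and f = \<Phi> and g = \<Psi>])
        (use bundle_iso_fiber[OF F gy(1)] gy v I proper_fiber[OF I(4)] in
          \<open>auto simp: vector_pseudo_bundle_def fiber_def\<close>)
  qed
  have "subduction (total_space F') (base_space F') (proj F')"
    by (rule subduction_transfer[OF I(6) I(5), where h = "proj F"])
      (use I v in \<open>auto simp: vector_pseudo_bundle_def\<close>)
  then show ?thesis
    using fib v I smooth_fiberwise_operations_transfer[OF F]
      diffeological_space_transfer[OF I(5)] diffeological_space_transfer[OF I(6)]
    by (auto simp: vector_pseudo_bundle_def)
qed

text \<open>The typical-fiber condition defining a singularity is tested on restrictions to members
  of a neighborhood base, so the isomorphism has to restrict to arbitrary sets \<open>V\<close> of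
  base points.\<close>

lemma bundle_iso_restrict:
  assumes F: "bundle_iso F F' f g \<Phi> \<Psi>" and V: "V \<subseteq> points (base_space F)"
  shows "bundle_iso (restrict_bundle F V) (restrict_bundle F' (f ` V)) f g \<Phi> \<Psi>"
proof -
  note I = bundle_isoD[OF F]
  have inV: "f x \<in> f ` V \<longleftrightarrow> x \<in> V" if "x \<in> points (base_space F)" for x
    using bundle_iso_inj[OF F that] V by (auto 4 3)
  have "dspace_iso (subset_dspace (base_space F) V) (subset_dspace (base_space F') (f ` V)) f g"
    by (rule dspace_iso_subset) (use I inV in auto)
  moreover have "dspace_iso (subset_dspace (total_space F) {e. proj F e \<in> V})
      (subset_dspace (total_space F') {e. proj F' e \<in> f ` V}) \<Phi> \<Psi>"
    by (rule dspace_iso_subset) (use I inV in auto)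
  ultimately show ?thesis
    using I by (simp add: bundle_iso_def restrict_bundle_def proper_subset_dspace)
qed

lemma fiber_restrict_bundle: "x \<in> V \<Longrightarrow> fiber (restrict_bundle F V) x = fiber F x"
proof -
  assume "x \<in> V"
  then have "{e. proj F e \<in> V} \<inter> {e. proj F e = x} = {e. proj F e = x}" by auto
  then show ?thesis by (simp add: fiber_def restrict_bundle_def subset_subset_dspace)
qed

section \<open>Diffeomorphisms acting on natural bundles\<close>

text \<open>The restriction makes the inverse extensional, hence again an element of
  \<open>diffeomorphisms X\<close>, and makes inversion an involution.\<close>

definition inv_diffeo :: "'a dspace \<Rightarrow> ('a \<Rightarrow> 'a) \<Rightarrow> 'a \<Rightarrow> 'a" where
  "inv_diffeo X f = restrict (inv_into (points X) f) (points X)"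

lemma diffeomorphism_dspace_iso:
  assumes X: "proper_plots X" and f: "f \<in> diffeomorphisms X"
  shows "dspace_iso X X f (inv_diffeo X f)"
proof -
  have b: "bij_betw f (points X) (points X)" and s: "smooth_map X X f"
    and i: "smooth_map X X (inv_into (points X) f)"
    using f by (auto simp: diffeomorphisms_def)
  have "smooth_map X X (inv_diffeo X f)"
    by (rule smooth_map_cong[OF X i]) (simp add: inv_diffeo_def)
  then show ?thesis
    using s bij_betw_inv_into_left[OF b] bij_betw_inv_into_right[OF b] bij_betwE[OF b]
    by (auto simp: dspace_iso_def inv_diffeo_def)
qed

lemma dspace_iso_diffeomorphism:
  assumes X: "proper_plots X" and i: "dspace_iso X X f g"
    and ext: "f \<in> extensional (points X)" "g \<in> extensional (points X)"
  shows "f \<in> diffeomorphisms X" "inv_diffeo X f = g"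
proof -
  note b = dspace_iso_bij_betw[OF i]
  have eq: "g x = inv_into (points X) f x" if "x \<in> points X" for x
    using bij_betw_inv_into_left[OF b, of "g x"] dspace_isoD(4,6)[OF i] that by simp
  have "smooth_map X X (inv_into (points X) f)"
    using smooth_map_cong[OF X dspace_isoD(2)[OF i] eq] .
  then show "f \<in> diffeomorphisms X"
    using b ext dspace_isoD(1)[OF i] by (simp add: diffeomorphisms_def)
  show "inv_diffeo X f = g"
    by (rule extensionalityI[where A = "points X"]) (use eq ext in \<open>auto simp: inv_diffeo_def\<close>)
qed

lemma inv_diffeo:
  assumes X: "proper_plots X" and f: "f \<in> diffeomorphisms X"
  shows "inv_diffeo X f \<in> diffeomorphisms X" "inv_diffeo X (inv_diffeo X f) = f"
  by (rule dspace_iso_diffeomorphism[OF X dspace_iso_sym[OF diffeomorphism_dspace_iso[OF X f]]];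
      use f in \<open>simp add: diffeomorphisms_def inv_diffeo_def\<close>)+

text \<open>Isolates what the homotopy argument uses of a bundle: every diffeomorphism of the base
  is covered by an automorphism. Both bundles are later shown to qualify.\<close>

definition natural_bundle :: "('a, 'e) vbundle \<Rightarrow> bool" where
  "natural_bundle F \<longleftrightarrow> diffeological_space (base_space F) \<and> proper_plots (total_space F) \<and>
     (\<forall>f\<in>diffeomorphisms (base_space F). \<exists>\<Phi> \<Psi>. bundle_iso F F f (inv_diffeo (base_space F) f) \<Phi> \<Psi>)"

lemma natural_bundleD:
  assumes "natural_bundle F"
  shows "diffeological_space (base_space F)" "proper_plots (base_space F)" "proper_plots (total_space F)"
  using assms by (auto simp: natural_bundle_def diffeological_imp_proper)

lemma natural_bundleE:
  assumes "natural_bundle F" "f \<in> diffeomorphisms (base_space F)"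
  obtains \<Phi> \<Psi> where "bundle_iso F F f (inv_diffeo (base_space F) f) \<Phi> \<Psi>"
  using assms unfolding natural_bundle_def by blast

text \<open>The second direction is the first one for the inverse diffeomorphism, applied at
  \<open>f x\<close>.\<close>

lemma natural_bundle_fibers_isomorphic:
  assumes F: "natural_bundle F" and f: "f \<in> diffeomorphisms (base_space F)"
    and x: "x \<in> points (base_space F)"
  shows "dvs_isomorphic (fiber F x) (fiber F (f x))" "dvs_isomorphic (fiber F (f x)) (fiber F x)"
proof -
  note X = natural_bundleD(2)[OF F]
  have *: "dvs_isomorphic (fiber F y) (fiber F (h y))"
    if "h \<in> diffeomorphisms (base_space F)" "y \<in> points (base_space F)" for h y
    using natural_bundleE[OF F that(1)] bundle_iso_fibers_isomorphic that(2) by metis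
  show "dvs_isomorphic (fiber F x) (fiber F (f x))" by (rule *[OF f x])
  note i = diffeomorphism_dspace_iso[OF X f]
  show "dvs_isomorphic (fiber F (f x)) (fiber F x)"
    using *[OF inv_diffeo(1)[OF X f] dspace_isoD(5)[OF i x]] dspace_isoD(3)[OF i x] by simp
qed

lemma fiber_locus_invariant:
  assumes F: "natural_bundle F" and f: "f \<in> diffeomorphisms (base_space F)"
    and V: "proper_plots (vspace V)" and x: "x \<in> fiber_locus F V"
  shows "f x \<in> fiber_locus F V"
proof -
  have x': "x \<in> points (base_space F)" "dvs_isomorphic (fiber F x) V"
    using x by (auto simp: fiber_locus_def)
  have "dvs_isomorphic (fiber F (f x)) V"
    using dvs_isomorphic_trans[OF natural_bundle_fibers_isomorphic(2)[OF F f x'(1)] x'(2) V] .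
  moreover have "f x \<in> points (base_space F)"
    using dspace_isoD(5)[OF diffeomorphism_dspace_iso[OF natural_bundleD(2)[OF F] f] x'(1)] .
  ultimately show ?thesis by (simp add: fiber_locus_def)
qed

section \<open>The D-topology and the invariance of singularities\<close>

lemma D_open_iff:
  "D_open X A \<longleftrightarrow> A \<subseteq> points X \<and>
     (\<forall>n U p. (n, U, p) \<in> plots X \<longrightarrow> openin (Euclidean_space n) {u\<in>U. p u \<in> A})"
  unfolding D_open_def Ball_triple ..

lemma D_open_points: "proper_plots X \<Longrightarrow> D_open X (points X)"
  unfolding D_open_iff
proof (intro conjI allI impI subset_refl)
  fix n U p assume X: "proper_plots X" and p: "(n, U, p) \<in> plots X"
  have "{u\<in>U. p u \<in> points X} = U" using proper_plotsD(4)[OF X p] by blast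
  then show "openin (Euclidean_space n) {u\<in>U. p u \<in> points X}"
    using proper_plotsD(1)[OF X p] by simp
qed

text \<open>Stated for proper plots so that it also covers the subspace diffeology of a
  locus.\<close>

lemma topspace_D_topology_proper:
  assumes "proper_plots X"
  shows "topspace (D_topology X) = points X"
proof
  show "topspace (D_topology X) \<subseteq> points X"
    by (metis D_open_iff openin_D_topology openin_topspace)
  show "points X \<subseteq> topspace (D_topology X)"
    using D_open_points[OF assms] by (metis openin_D_topology openin_subset)
qed

text \<open>A plot \<open>q\<close> of \<open>Y\<close> meets the image of \<open>A\<close> exactly
  where the composite of \<open>q\<close> with \<open>g\<close>, a plot of \<open>X\<close>, meets
  \<open>A\<close>.\<close>

lemma D_open_image:
  assumes i: "dspace_iso X Y f g" and Y: "proper_plots Y" and A: "D_open X A"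
  shows "D_open Y (f ` A)"
  unfolding D_open_iff
proof (intro conjI allI impI)
  have AX: "A \<subseteq> points X" using A by (simp add: D_open_iff)
  then show "f ` A \<subseteq> points Y" using dspace_isoD(5)[OF i] by blast
  fix n U q assume q: "(n, U, q) \<in> plots Y"
  have "q u \<in> f ` A \<longleftrightarrow> g (q u) \<in> A" if "u \<in> U" for u
  proof
    assume "q u \<in> f ` A"
    then obtain a where "a \<in> A" "q u = f a" by blast
    then show "g (q u) \<in> A" using AX dspace_isoD(3)[OF i, of a] by auto
  next
    assume "g (q u) \<in> A"
    then show "q u \<in> f ` A"
      using dspace_isoD(4)[OF i proper_plotsD(4)[OF Y q that]] by (intro image_eqI[of _ _ "g (q u)"]) simp_all
  qed
  then have "{u\<in>U. q u \<in> f ` A} = {u\<in>U. compose U g q u \<in> A}" by (auto simp: compose_def)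
  then show "openin (Euclidean_space n) {u\<in>U. q u \<in> f ` A}"
    using A dspace_isoD(8)[OF i q] by (simp add: D_open_iff)
qed

text \<open>Members of a base need not be open, so the open set inside each of them is moved along
  by \<open>D_open_image\<close>. Conversely, an open \<open>W\<close> around \<open>f x\<close> is
  brought back by \<open>g\<close>, a base member is found inside it at \<open>x\<close>, and that
  member is sent forward again.\<close>

lemma neighborhood_base_image:
  assumes i: "dspace_iso X Y f g" and X: "proper_plots X" and Y: "proper_plots Y"
    and V: "neighborhood_base (D_topology X) x \<V>" and x: "x \<in> points X"
  shows "neighborhood_base (D_topology Y) (f x) ((`) f ` \<V>)"
proof -
  note V' = V[unfolded neighborhood_base_def openin_D_topology topspace_D_topology_proper[OF X]]
  have base: "f ` B \<subseteq> points Y \<and> (\<exists>W. D_open Y W \<and> f x \<in> W \<and> W \<subseteq> f ` B)" if B: "B \<in> \<V>" for B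
  proof -
    obtain W where W: "B \<subseteq> points X" "D_open X W" "x \<in> W" "W \<subseteq> B"
      using bspec[OF conjunct1[OF V'] B] by (elim conjE exE)
    have "f ` B \<subseteq> points Y" using W(1) dspace_isoD(5)[OF i] by (auto simp: subset_iff)
    moreover have "f x \<in> f ` W" "f ` W \<subseteq> f ` B" using W(3,4) by auto
    ultimately show ?thesis using D_open_image[OF i Y W(2)] by metis
  qed
  have "\<exists>V\<in>(`) f ` \<V>. V \<subseteq> W" if W: "D_open Y W" "f x \<in> W" for W
  proof -
    have "D_open X (g ` W)" using D_open_image[OF dspace_iso_sym[OF i] X W(1)] .
    moreover have "x \<in> g ` W"
      using W(2) dspace_isoD(3)[OF i x] by (intro image_eqI[where x = "f x"]) auto
    ultimately obtain B where B: "B \<in> \<V>" "B \<subseteq> g ` W" using conjunct2[OF V'] by metis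
    have WY: "W \<subseteq> points Y" using W(1) by (simp add: D_open_iff)
    have "f ` B \<subseteq> W"
    proof clarify
      fix y assume "y \<in> B"
      then obtain w where "w \<in> W" "y = g w" using B(2) by auto
      then show "f y \<in> W" using dspace_isoD(4)[OF i, of w] WY by auto
    qed
    then show ?thesis using B(1) by auto
  qed
  then show ?thesis
    unfolding neighborhood_base_def openin_D_topology topspace_D_topology_proper[OF Y]
    using base by simp
qed

lemma typical_fiber_transfer:
  assumes F: "natural_bundle F" and f: "f \<in> diffeomorphisms (base_space F)"
    and x: "x \<in> points (base_space F)" and V: "V \<subseteq> points (base_space F)"
    and v: "vector_bundle_with_typical_fiber (restrict_bundle F V) (fiber F x)"
  shows "vector_bundle_with_typical_fiber (restrict_bundle F (f ` V)) (fiber F (f x))"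
  unfolding vector_bundle_with_typical_fiber_def
proof (intro conjI ballI)
  obtain \<Phi> \<Psi> where i: "bundle_iso F F f (inv_diffeo (base_space F) f) \<Phi> \<Psi>"
    using natural_bundleE[OF F f] .
  show "vector_pseudo_bundle (restrict_bundle F (f ` V))"
    using vector_pseudo_bundle_transfer[OF bundle_iso_restrict[OF i V]] v
    by (simp add: vector_bundle_with_typical_fiber_def)
  fix y' assume y': "y' \<in> points (base_space (restrict_bundle F (f ` V)))"
  then obtain y where y: "y \<in> V" "y' = f y" by (auto simp: restrict_bundle_def)
  then have yX: "y \<in> points (base_space F)" using V by blast
  have "dvs_isomorphic (fiber F y) (fiber F x)"
  proof -
    have "y \<in> points (base_space (restrict_bundle F V))"
      using y(1) yX by (simp add: restrict_bundle_def)
    then have "dvs_isomorphic (fiber (restrict_bundle F V) y) (fiber F x)"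
      using v by (simp add: vector_bundle_with_typical_fiber_def)
    then show ?thesis by (simp only: fiber_restrict_bundle[OF y(1)])
  qed
  \<comment> \<open>The chain runs from the fiber over \<open>f y\<close> to those over
    \<open>y\<close>, \<open>x\<close> and \<open>f x\<close>; the middle link is the hypothesis on
    \<open>V\<close>.\<close>
  then have "dvs_isomorphic (fiber F (f y)) (fiber F (f x))"
    using natural_bundle_fibers_isomorphic[OF F f] yX x dvs_isomorphic_trans
      proper_fiber[OF natural_bundleD(3)[OF F]] by metis
  then show "dvs_isomorphic (fiber (restrict_bundle F (f ` V)) y') (fiber F (f x))"
    using fiber_restrict_bundle[of y' "f ` V" F] y by simp
qed

text \<open>Contrapositive with the inverse diffeomorphism: a base at \<open>f x\<close> witnessing
  that \<open>f x\<close> is regular is carried to such a base at \<open>x\<close>.\<close>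

lemma F_singularities_invariant:
  assumes F: "natural_bundle F" and f: "f \<in> diffeomorphisms (base_space F)"
    and x: "x \<in> F_singularities F"
  shows "f x \<in> F_singularities F"
proof -
  let ?X = "base_space F" and ?g = "inv_diffeo (base_space F) f"
  note X = natural_bundleD(2)[OF F]
  note i = diffeomorphism_dspace_iso[OF X f]
  have xX: "x \<in> points ?X" using x by (simp add: F_singularities_def)
  have fx: "f x \<in> points ?X" and gfx: "?g (f x) = x"
    using dspace_isoD(3,5)[OF i xX] by auto
  show ?thesis
  proof (rule ccontr)
    assume "f x \<notin> F_singularities F"
    then obtain \<V> where N: "neighborhood_base (D_topology ?X) (f x) \<V>"
      and v: "\<And>V. V \<in> \<V> \<Longrightarrow> vector_bundle_with_typical_fiber (restrict_bundle F V) (fiber F (f x))"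
      using fx by (auto simp: F_singularities_def)
    have sub: "V \<subseteq> points ?X" if "V \<in> \<V>" for V
      using N that topspace_D_topology_proper[OF X] by (auto simp: neighborhood_base_def)
    have "neighborhood_base (D_topology ?X) x ((`) ?g ` \<V>)"
      using neighborhood_base_image[OF dspace_iso_sym[OF i] X X N fx] gfx by simp
    moreover have "vector_bundle_with_typical_fiber (restrict_bundle F V) (fiber F x)"
      if "V \<in> (`) ?g ` \<V>" for V
      using that typical_fiber_transfer[OF F inv_diffeo(1)[OF X f] fx sub v] gfx by auto
    ultimately show False using x by (auto simp: F_singularities_def)
  qed
qed

section \<open>Smooth paths\<close>

text \<open>The D-topology is defined so that a plot is continuous on its domain.\<close>

lemma connectedin_plot_image:
  assumes X: "proper_plots X" and p: "(n, U, p) \<in> plots X"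
    and U: "connectedin (Euclidean_space n) U"
  shows "connectedin (D_topology X) (p ` U)"
proof -
  have Usub: "U \<subseteq> Euc n" using connectedin_subset_topspace[OF U] .
  have "continuous_map (subtopology (Euclidean_space n) U) (D_topology X) p"
    unfolding continuous_map_def openin_D_topology topspace_D_topology_proper[OF X]
  proof (intro conjI allI impI)
    show "p \<in> topspace (subtopology (Euclidean_space n) U) \<rightarrow> points X"
      using proper_plotsD(4)[OF X p] by auto
    fix A assume A: "D_open X A"
    have "{u \<in> topspace (subtopology (Euclidean_space n) U). p u \<in> A} = {u\<in>U. p u \<in> A}"
      using Usub by auto
    moreover have "openin (Euclidean_space n) {u\<in>U. p u \<in> A}" using A p by (simp add: D_open_iff)
    ultimately show "openin (subtopology (Euclidean_space n) U)
        {u \<in> topspace (subtopology (Euclidean_space n) U). p u \<in> A}"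
      by (auto simp: openin_subtopology)
  qed
  moreover have "connectedin (subtopology (Euclidean_space n) U) U"
    using U by (simp add: connectedin_subtopology)
  ultimately show ?thesis by (rule connectedin_continuous_map_image)
qed

section \<open>Smoothness of constants, coordinates and translations\<close>

lemma continuous_map_euc_coordinate:
  "continuous_map (subtopology (Euclidean_space n) U) euclideanreal (\<lambda>x. x i)"
  unfolding Euclidean_space_def
  by (intro continuous_map_from_subtopology continuous_map_product_projection) simp

lemma smooth_on_const: "smooth_on n U (\<lambda>x. c)"
proof -
  have p: "partial i (\<lambda>x. c) = (\<lambda>x. 0)" for i and c :: real
    by (auto simp: partial_def)
  have "Ck_on k n U (\<lambda>x. c)" for k and c :: real
    by (induction k arbitrary: c) (auto simp: p)
  then show ?thesis by (simp add: smooth_on_def)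
qed

text \<open>The first partials are the constants 0 and 1, so all higher orders reduce to
  \<open>smooth_on_const\<close> and a case split replaces induction.\<close>

lemma smooth_on_translation: "smooth_on n U (\<lambda>x. c + x i)"
proof -
  have d: "((\<lambda>t. c + (x(j := t)) i) has_field_derivative (if j = i then 1 else 0)) (at s)" for x j s
    by (auto intro!: derivative_eq_intros)
  have p: "partial j (\<lambda>x. c + x i) = (\<lambda>x. if j = i then 1 else 0)" for j
    using DERIV_imp_deriv[OF d] by (auto simp: partial_def fun_eq_iff)
  have "Ck_on k n U (\<lambda>x. c + x i)" for k
  proof (cases k)
    case 0
    then show ?thesis by (auto intro!: continuous_map_add continuous_map_euc_coordinate)
  next
    case (Suc l)
    have "Ck_on l n U (\<lambda>x. if j = i then 1 else 0)" for j
      using smooth_on_const[of n U "if j = i then 1 else 0"] by (simp add: smooth_on_def)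
    moreover have "(\<lambda>t. c + (x(j := t)) i) field_differentiable at s" for x j s
      using d unfolding field_differentiable_def by blast
    ultimately show ?thesis
      unfolding Suc Ck_on.simps p
      by (auto intro!: continuous_map_add continuous_map_euc_coordinate simp del: fun_upd_apply)
  qed
  then show ?thesis by (simp add: smooth_on_def)
qed

lemma smooth_euc_translation:
  assumes "(\<lambda>x. a + x) \<in> U \<rightarrow> V" "V \<subseteq> Euc m"
  shows "smooth_euc n U m V (\<lambda>x. a + x)"
  using assms smooth_on_translation by (simp add: smooth_euc_def)

text \<open>The coordinate lines \<open>x(i := t)\<close> with \<open>i < n\<close> never leave
  \<open>Euc n\<close>, so \<open>partial\<close> sees only values on which \<open>f\<close> and
  \<open>g\<close> agree. This admits the extensional versions of coordinate functions, which are
  \<open>undefined\<close> off \<open>Euc n\<close>.\<close>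

lemma Ck_on_Euc_cong:
  assumes "Ck_on k n (Euc n) f" "\<And>x. x \<in> Euc n \<Longrightarrow> f x = g x"
  shows "Ck_on k n (Euc n) g"
  using assms
proof (induction k arbitrary: f g)
  case 0
  then show ?case by (auto intro: continuous_map_eq)
next
  case (Suc k)
  have eq: "(\<lambda>t. f (x(i := t))) = (\<lambda>t. g (x(i := t)))" if "i < n" "x \<in> Euc n" for i x
    using that by (intro ext Suc.prems(2)) (auto simp: topspace_Euclidean_space)
  have "Ck_on k n (Euc n) (partial i g)" if "i < n" for i
  proof (rule Suc.IH)
    show "Ck_on k n (Euc n) (partial i f)" using Suc.prems(1) that by simp
    show "partial i f x = partial i g x" if "x \<in> Euc n" for x
      using eq[OF \<open>i < n\<close> that] by (simp add: partial_def)
  qed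
  then show ?case
    using Suc.prems eq by (auto intro: continuous_map_eq)
qed

lemma smooth_on_Euc_coordinate:
  assumes "\<And>x. x \<in> Euc n \<Longrightarrow> h x = x i"
  shows "smooth_on n (Euc n) h"
  unfolding smooth_on_def
proof
  fix k
  have "Ck_on k n (Euc n) (\<lambda>x. 0 + x i)"
    using smooth_on_translation unfolding smooth_on_def by blast
  then show "Ck_on k n (Euc n) h"
    by (rule Ck_on_Euc_cong) (simp add: assms)
qed

lemma euclidean_identity_plot: "(n, Euc n, \<lambda>u\<in>Euc n. u) \<in> plots (euclidean_dspace n)"
proof -
  have "smooth_on n (Euc n) (\<lambda>x. (\<lambda>u\<in>Euc n. u) x i)" for i
    by (rule smooth_on_Euc_coordinate) simp
  then show ?thesis by (simp add: euclidean_dspace_def smooth_euc_def)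
qed

text \<open>Plot domains live in the spaces \<open>Euc n\<close>, so the real line of times is
  replaced by \<open>Euc 1\<close>, with time as the coordinate \<open>u 0\<close>. Composing the
  homotopy with this coordinate gives a plot of \<open>Diff_dspace X\<close>, and evaluating it at
  \<open>x\<close> gives the orbit of \<open>x\<close> as a plot of \<open>X\<close>.\<close>

lemma smoothly_homotopic_to_idE:
  assumes X: "diffeological_space X" and h: "smoothly_homotopic_to_id X \<phi>"
  obtains \<gamma> where "\<And>t. \<gamma> t \<in> diffeomorphisms X" "\<gamma> 0 = (\<lambda>x\<in>points X. x)" "\<gamma> 1 = \<phi>"
    "\<And>x. x \<in> points X \<Longrightarrow> (1, Euc 1, \<lambda>u\<in>Euc 1. \<gamma> (u 0) x) \<in> plots X"
proof -
  obtain \<gamma> where \<gamma>: "smooth_map real_dspace (Diff_dspace X) \<gamma>"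
    "\<gamma> 0 = (\<lambda>x\<in>points X. x)" "\<gamma> 1 = \<phi>"
    using h unfolding smoothly_homotopic_to_id_def by blast
  have "\<gamma> t \<in> diffeomorphisms X" for t
    using smooth_map_points[OF \<gamma>(1), of t] by (simp add: real_dspace_def Diff_dspace_def)
  moreover have "(1, Euc 1, \<lambda>u\<in>Euc 1. \<gamma> (u 0) x) \<in> plots X" if x: "x \<in> points X" for x
  proof -
    let ?P = "compose (Euc 1) \<gamma> (\<lambda>u\<in>Euc 1. u 0)"
    let ?E = "subset_dspace (euclidean_dspace 1) (Euc 1)"
    have "(1, Euc 1, \<lambda>u\<in>Euc 1. u 0) \<in> plots real_dspace"
      using smooth_on_Euc_coordinate[of 1 "\<lambda>u\<in>Euc 1. u 0" 0] by (simp add: real_dspace_def)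
    from smooth_map_plots[OF \<gamma>(1) this]
    have P: "smooth_map (prod_dspace ?E X) X (\<lambda>(u, x). ?P u x)"
      by (simp add: Diff_dspace_def)
    have "compose (Euc 1) fst (\<lambda>u\<in>Euc 1. (u, x)) = (\<lambda>u\<in>Euc 1. u)"
      "compose (Euc 1) snd (\<lambda>u\<in>Euc 1. (u, x)) = (\<lambda>u\<in>Euc 1. x)"
      by (auto simp: compose_def)
    moreover have "(1, Euc 1, \<lambda>u\<in>Euc 1. u) \<in> plots ?E"
      using euclidean_identity_plot[of 1] by (auto simp: subset_dspace_def)
    moreover have "(1, Euc 1, \<lambda>u\<in>Euc 1. x) \<in> plots X"
      by (rule diffeological_constant[OF X x]) simp
    \<comment> \<open>Evaluation is jointly smooth in the parameter and the point; this plot of the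
      product freezes the point at \<open>x\<close>.\<close>
    ultimately have "(1, Euc 1, \<lambda>u\<in>Euc 1. (u, x)) \<in> plots (prod_dspace ?E X)"
      by (simp add: prod_dspace_def)
    from smooth_map_plots[OF P this] show ?thesis
      by (simp add: compose_def cong: restrict_cong)
  qed
  ultimately show ?thesis using \<gamma>(2,3) that by blast
qed

text \<open>Since \<open>x\<close> and \<open>f x\<close> share a connected set, \<open>x\<close>
  lies in \<open>C\<close> if and only if \<open>f x\<close> does. One direction gives the first
  inclusion, the other together with surjectivity of \<open>f\<close> gives the second.\<close>

lemma component_invariant:
  assumes bij: "bij_betw f (topspace T) (topspace T)"
    and path: "\<And>x. x \<in> topspace T \<Longrightarrow> \<exists>S. connectedin T S \<and> x \<in> S \<and> f x \<in> S"
    and C: "C \<in> connected_components_of T"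
  shows "f ` C = C"
proof -
  have CT: "C \<subseteq> topspace T" using connected_components_of_subset[OF C] .
  have con: "connectedin T C" using connectedin_connected_components_of[OF C] .
  have stay: "x \<in> C \<longleftrightarrow> f x \<in> C" if x: "x \<in> topspace T" for x
  proof -
    obtain S where S: "connectedin T S" "x \<in> S" "f x \<in> S" using path[OF x] by blast
    have "S \<subseteq> C" if "\<not> disjnt C S"
      using connected_components_of_maximal[OF C S(1) that] .
    then show ?thesis using S(2,3) by (auto simp: disjnt_iff)
  qed
  show ?thesis
  proof
    show "f ` C \<subseteq> C" using stay CT by blast
    show "C \<subseteq> f ` C"
    proof
      fix y assume y: "y \<in> C"
      then obtain x where "x \<in> topspace T" "y = f x"
        using bij CT by (metis bij_betw_imp_surj_on imageE subsetD)
      then show "y \<in> f ` C" using stay y by blast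
    qed
  qed
qed

text \<open>All singletons are open in \<open>K\<close>, hence so is \<open>K - {x}\<close> as a
  union of them, and connectedness forces it to be empty. No singleton is assumed closed.\<close>

lemma connected_subset_of_isolated_points:
  assumes K: "connectedin T K" and x: "x \<in> K" and iso: "\<And>y. y \<in> K \<Longrightarrow> openin (subtopology T K) {y}"
  shows "K = {x}"
proof -
  have "openin (subtopology T K) (\<Union>y\<in>K - {x}. {y})"
    using iso by (intro openin_Union) auto
  then have o: "openin (subtopology T K) (K - {x})" by simp
  have "connected_space (subtopology T K)" using K by (simp add: connectedin_def)
  moreover have "topspace (subtopology T K) = K" using connectedin_subset_topspace[OF K] by auto
  ultimately have "K - {x} = {}"
    using iso[OF x] o x unfolding connected_space_def by blast
  then show ?thesis using x by blast
qed

text \<open>A locus carries two topologies: the one induced by the D-topology of the base, and the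
  D-topology of its subspace diffeology, which is at least as fine. Connected components can be
  taken in either sense, and both are treated.\<close>

theorem natural_bundle_homotopy:
  assumes F: "natural_bundle F" and phi: "\<phi> \<in> diffeomorphisms (base_space F)"
    and h: "smoothly_homotopic_to_id (base_space F) \<phi>"
  shows natural_bundle_components: "fiber_collection F \<F> \<Longrightarrow> V \<in> \<F> \<Longrightarrow>
      (\<forall>C\<in>connected_components_of (subtopology (D_topology (base_space F)) (fiber_locus F V)). \<phi> ` C = C) \<and>
      (\<forall>C\<in>connected_components_of (D_topology (subset_dspace (base_space F) (fiber_locus F V))). \<phi> ` C = C)"
    and natural_bundle_isolated: "isolated_F_singularity F x \<Longrightarrow> \<phi> x = x"
proof -
  let ?X = "base_space F"
  note X = natural_bundleD(1,2)[OF F]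
  obtain \<gamma> where \<gamma>: "\<And>t. \<gamma> t \<in> diffeomorphisms ?X" "\<gamma> 0 = (\<lambda>x\<in>points ?X. x)" "\<gamma> 1 = \<phi>"
    "\<And>x. x \<in> points ?X \<Longrightarrow> (1, Euc 1, \<lambda>u\<in>Euc 1. \<gamma> (u 0) x) \<in> plots ?X"
    by (rule smoothly_homotopic_to_idE[OF X(1) h]) blast
  let ?c = "\<lambda>x. \<lambda>u\<in>Euc 1. \<gamma> (u 0) x"
  have Euc1: "(\<lambda>i. if i = 0 then t else 0) \<in> Euc 1" for t :: real
    by (simp add: topspace_Euclidean_space)
  have img: "?c x ` Euc 1 = range (\<lambda>t. \<gamma> t x)" for x
  proof
    show "range (\<lambda>t. \<gamma> t x) \<subseteq> ?c x ` Euc 1"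
    proof clarify
      fix t show "\<gamma> t x \<in> ?c x ` Euc 1"
        by (rule image_eqI[OF _ Euc1[of t]]) (simp add: topspace_Euclidean_space)
    qed
  qed auto
  have conE: "connectedin (Euclidean_space 1) (Euc 1)"
    by (simp add: connectedin_topspace connected_Euclidean_space)
  have ends: "x \<in> range (\<lambda>t. \<gamma> t x)" "\<phi> x \<in> range (\<lambda>t. \<gamma> t x)" if "x \<in> points ?X" for x
    using \<gamma>(2,3) that by (metis rangeI restrict_apply', metis rangeI)
  \<comment> \<open>An orbit that stays in \<open>A\<close> is a plot of the subspace diffeology, so
    it is connected in the possibly finer topology of \<open>A\<close> and not merely in that of the
    base.\<close>
  have path: "connectedin (D_topology (subset_dspace ?X A)) (range (\<lambda>t. \<gamma> t x))"
    if "x \<in> points ?X" "range (\<lambda>t. \<gamma> t x) \<subseteq> A" for x A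
  proof -
    have "(1, Euc 1, ?c x) \<in> plots (subset_dspace ?X A)"
      using \<gamma>(4)[OF that(1)] that(2) by (auto simp: subset_dspace_def)
    from connectedin_plot_image[OF proper_subset_dspace[OF X(2)] this conE] show ?thesis
      unfolding img .
  qed
  have "subset_dspace ?X UNIV = ?X" by (simp add: subset_dspace_def)
  then have pathX: "connectedin (D_topology ?X) (range (\<lambda>t. \<gamma> t x))" if "x \<in> points ?X" for x
    using path[OF that, of UNIV] by simp
  show "(\<forall>C\<in>connected_components_of (subtopology (D_topology ?X) (fiber_locus F V)). \<phi> ` C = C) \<and>
      (\<forall>C\<in>connected_components_of (D_topology (subset_dspace ?X (fiber_locus F V))). \<phi> ` C = C)"
    if "fiber_collection F \<F>" "V \<in> \<F>"
  proof -
    obtain z where "V = fiber F z" using \<open>fiber_collection F \<F>\<close> \<open>V \<in> \<F>\<close>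
      by (auto simp: fiber_collection_def)
    then have V: "proper_plots (vspace V)" using proper_fiber[OF natural_bundleD(3)[OF F]] by simp
    let ?L = "fiber_locus F V"
    have LX: "?L \<subseteq> points ?X" by (auto simp: fiber_locus_def)
    note inv = fiber_locus_invariant[OF F _ V]
    note i = diffeomorphism_dspace_iso[OF X(2) phi]
    \<comment> \<open>The inverse diffeomorphism preserves the locus as well, which supplies the
      surjectivity.\<close>
    have bij: "bij_betw \<phi> ?L ?L"
      by (rule bij_betw_byWitness[where f' = "inv_diffeo ?X \<phi>"])
        (use dspace_isoD(3,4)[OF i] LX inv[OF phi] inv[OF inv_diffeo(1)[OF X(2) phi]] in auto)
    have range: "range (\<lambda>t. \<gamma> t x) \<subseteq> ?L" if "x \<in> ?L" for x
      using inv[OF \<gamma>(1) that] by blast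
    have T1: "topspace (subtopology (D_topology ?X) ?L) = ?L"
      using LX topspace_D_topology_proper[OF X(2)] by auto
    have T2: "topspace (D_topology (subset_dspace ?X ?L)) = ?L"
      using LX topspace_D_topology_proper[OF proper_subset_dspace[OF X(2)]] by auto
    show ?thesis
    proof (intro conjI ballI)
      fix C assume C: "C \<in> connected_components_of (subtopology (D_topology ?X) ?L)"
      show "\<phi> ` C = C"
      proof (rule component_invariant[OF _ _ C], unfold T1, rule bij)
        fix x assume x: "x \<in> ?L"
        then show "\<exists>S. connectedin (subtopology (D_topology ?X) ?L) S \<and> x \<in> S \<and> \<phi> x \<in> S"
          using pathX ends range[OF x] LX by (metis connectedin_subtopology subsetD)
      qed
    next
      fix C assume C: "C \<in> connected_components_of (D_topology (subset_dspace ?X ?L))"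
      show "\<phi> ` C = C"
      proof (rule component_invariant[OF _ _ C], unfold T2, rule bij)
        fix x assume x: "x \<in> ?L"
        then show "\<exists>S. connectedin (D_topology (subset_dspace ?X ?L)) S \<and> x \<in> S \<and> \<phi> x \<in> S"
          using path ends range[OF x] LX by (metis subsetD)
      qed
    qed
  qed
  show "\<phi> x = x" if iso: "isolated_F_singularity F x"
  proof -
    let ?S = "F_singularities F" and ?K = "range (\<lambda>t. \<gamma> t x)"
    have xS: "x \<in> ?S" and op: "openin (subtopology (D_topology ?X) ?S) {x}"
      using iso by (auto simp: isolated_F_singularity_def)
    have xX: "x \<in> points ?X" using xS by (simp add: F_singularities_def)
    have KS: "?K \<subseteq> ?S" using F_singularities_invariant[OF F \<gamma>(1) xS] by blast
    obtain W where W: "D_open ?X W" "{x} = W \<inter> ?S"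
      using op by (auto simp: openin_subtopology openin_D_topology)
    have "openin (subtopology (D_topology ?X) ?K) {y}" if y: "y \<in> ?K" for y
    proof -
      obtain t where t: "y = \<gamma> t x" using y by blast
      note i = diffeomorphism_dspace_iso[OF X(2) \<gamma>(1)[of t]]
      \<comment> \<open>The D-open set \<open>W\<close> isolates \<open>x\<close>, and its image
        under \<open>\<gamma> t\<close> isolates \<open>y\<close>: a singularity in that image is
        brought back by the inverse of \<open>\<gamma> t\<close> to a singularity in
        \<open>W\<close>, which can only be \<open>x\<close>.\<close>
      have "\<gamma> t ` W \<inter> ?S \<subseteq> {y}"
      proof
        fix z assume z: "z \<in> \<gamma> t ` W \<inter> ?S"
        then obtain w where w: "w \<in> W" "z = \<gamma> t w" by blast
        have wX: "w \<in> points ?X" using W(1) w(1) by (auto simp: D_open_iff)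
        have "inv_diffeo ?X (\<gamma> t) z \<in> ?S"
          using F_singularities_invariant[OF F inv_diffeo(1)[OF X(2) \<gamma>(1)]] z by blast
        then have "w \<in> ?S" using dspace_isoD(3)[OF i wX] w(2) by simp
        then have "w = x" using W(2) w(1) by blast
        then show "z \<in> {y}" using w(2) t by simp
      qed
      moreover have "y \<in> \<gamma> t ` W" using W(2) t by blast
      ultimately have "{y} = \<gamma> t ` W \<inter> ?K" using KS y by blast
      then show ?thesis
        using D_open_image[OF i X(2) W(1)] by (auto simp: openin_subtopology openin_D_topology)
    qed
    then have "?K = {x}"
      using connected_subset_of_isolated_points[OF pathX[OF xX] ends(1)[OF xX]] by blast
    then show ?thesis using ends(2)[OF xX] by blast
  qed
qed

section \<open>The cotangent bundle\<close>

text \<open>Serves both bundles, whose operations saturate a set of representatives under an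
  equivalence. The set \<open>A\<close> may exceed the field of \<open>r\<close>: sums and multiples
  of representatives qualify as soon as the two maps invert each other on them.\<close>

lemma image_Image_transport:
  assumes "\<And>a b. (a, b) \<in> r \<Longrightarrow> (F a, F b) \<in> r'" "\<And>a b. (a, b) \<in> r' \<Longrightarrow> (G a, G b) \<in> r"
    and "\<And>a. a \<in> A \<Longrightarrow> G (F a) = a" "\<And>a b. (a, b) \<in> r' \<Longrightarrow> F (G b) = b" "S \<subseteq> A"
  shows "F ` (r `` S) = r' `` (F ` S)"
proof
  show "F ` (r `` S) \<subseteq> r' `` (F ` S)" using assms(1) by blast
  show "r' `` (F ` S) \<subseteq> F ` (r `` S)"
  proof
    fix b assume "b \<in> r' `` (F ` S)"
    then obtain a where a: "a \<in> S" "(F a, b) \<in> r'" by blast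
    then have "(a, G b) \<in> r" using assms(2)[OF a(2)] assms(3,5) by force
    then show "b \<in> F ` (r `` S)"
      using a assms(4)[OF a(2)] by (intro image_eqI[of _ _ "G b"]) auto
  qed
qed

section \<open>Pullback of 1-forms by a smooth self-map\<close>

definition form_pullback :: "'a dspace \<Rightarrow> ('a \<Rightarrow> 'a) \<Rightarrow> 'a form \<Rightarrow> 'a form" where
  "form_pullback X g \<alpha> = (\<lambda>(n, U, p)\<in>plots X. \<alpha> (n, U, compose U g p))"

lemma form_pullback_apply:
  "(n, U, p) \<in> plots X \<Longrightarrow> form_pullback X g \<alpha> (n, U, p) = \<alpha> (n, U, compose U g p)"
  by (simp add: form_pullback_def)

lemma plot_function_eqI:
  assumes "\<alpha> \<in> extensional (plots X)" "\<beta> \<in> extensional (plots X)"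
    and "\<And>n U p. (n, U, p) \<in> plots X \<Longrightarrow> \<alpha> (n, U, p) = \<beta> (n, U, p)"
  shows "\<alpha> = \<beta>"
  using assms by (intro extensionalityI[where A = "plots X"]) auto

lemma form_operations_extensional [simp]:
  "form_pullback X g \<alpha> \<in> extensional (plots X)" "form_add X \<alpha> \<beta> \<in> extensional (plots X)"
  "form_scale X r \<alpha> \<in> extensional (plots X)" "form_zero X \<in> extensional (plots X)"
  by (simp_all add: form_pullback_def form_add_def form_scale_def form_zero_def)

lemma form_pullback_add:
  assumes "smooth_map X X g"
  shows "form_pullback X g (form_add X \<alpha> \<beta>) = form_add X (form_pullback X g \<alpha>) (form_pullback X g \<beta>)"
    "form_pullback X g (form_scale X r \<alpha>) = form_scale X r (form_pullback X g \<alpha>)"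
    "form_pullback X g (form_zero X) = form_zero X"
  by (rule plot_function_eqI[where X = X];
      simp add: fun_eq_iff form_pullback_apply form_add_def form_scale_def form_zero_def smooth_map_plots[OF assms])+

lemma form_pullback_inverse:
  assumes X: "proper_plots X" and i: "dspace_iso X X f g" and \<alpha>: "\<alpha> \<in> extensional (plots X)"
  shows "form_pullback X f (form_pullback X g \<alpha>) = \<alpha>"
proof (rule plot_function_eqI[OF _ \<alpha>])
  fix n U p assume p: "(n, U, p) \<in> plots X"
  have "compose U g (compose U f p) = p"
    unfolding compose_compose
    by (rule compose_id_on) (simp_all add: proper_plotsD[OF X p] dspace_isoD(3)[OF i])
  then show "form_pullback X f (form_pullback X g \<alpha>) (n, U, p) = \<alpha> (n, U, p)"
    using p dspace_isoD(7)[OF i p] by (simp add: form_pullback_apply)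
qed simp

lemma one_forms_iff:
  "\<alpha> \<in> one_forms X \<longleftrightarrow> \<alpha> \<in> extensional (plots X) \<and>
     (\<forall>n U p. (n, U, p) \<in> plots X \<longrightarrow> (n, U, \<alpha> (n, U, p)) \<in> plots (euclidean_dspace n)) \<and>
     (\<forall>n U p. (n, U, p) \<in> plots X \<longrightarrow>
        (\<forall>m V g. openin (Euclidean_space m) V \<and> smooth_euc m V n U g \<longrightarrow>
          (\<forall>w\<in>V. \<alpha> (m, V, compose V p g) w = pullback_form m n g (\<alpha> (n, U, p)) w)))"
  unfolding one_forms_def mem_Collect_eq Ball_triple ..

text \<open>Composing a plot with \<open>g\<close> on the left commutes with reparametrizing it on
  the right, so compatibility at \<open>p\<close> is the compatibility of \<open>\<alpha>\<close> at
  the composite of \<open>p\<close> with \<open>g\<close>.\<close>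

lemma form_pullback_one_forms:
  assumes X: "diffeological_space X" and g: "smooth_map X X g" and \<alpha>: "\<alpha> \<in> one_forms X"
  shows "form_pullback X g \<alpha> \<in> one_forms X"
  unfolding one_forms_iff
proof (intro conjI allI impI ballI)
  note \<alpha>' = \<alpha>[unfolded one_forms_iff]
  fix n U p assume p: "(n, U, p) \<in> plots X"
  note gp = smooth_map_plots[OF g p]
  show "(n, U, form_pullback X g \<alpha> (n, U, p)) \<in> plots (euclidean_dspace n)"
    using \<alpha>' gp p by (simp add: form_pullback_apply)
  fix m V h w assume h: "openin (Euclidean_space m) V \<and> smooth_euc m V n U h" and w: "w \<in> V"
  then have ph: "(m, V, compose V p h) \<in> plots X"
    using diffeological_reparametrize[OF X p] by blast
  have "h v \<in> U" if "v \<in> V" for v using h that by (auto simp: smooth_euc_def)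
  then have "compose V g (compose V p h) = compose V (compose U g p) h"
    by (auto simp: compose_def)
  then show "form_pullback X g \<alpha> (m, V, compose V p h) w =
      pullback_form m n h (form_pullback X g \<alpha> (n, U, p)) w"
    using \<alpha>' gp h w by (simp add: form_pullback_apply ph p)
qed simp

lemma proper_euclidean_dspace: "proper_plots (euclidean_dspace n)"
  by (auto simp: proper_plots_def euclidean_dspace_def)

text \<open>Joint smoothness of the pulled-back family at a plot \<open>p\<close> is that of the
  original family at the composite of \<open>p\<close> with \<open>g\<close>.\<close>

lemma form_pullback_smooth:
  assumes X: "diffeological_space X" and g: "smooth_map X X g"
  shows "smooth_map (one_forms_dspace X) (one_forms_dspace X) (form_pullback X g)"
proof (rule smooth_mapI)
  fix k T A assume "(k, T, A) \<in> plots (one_forms_dspace X)"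
  then have A: "openin (Euclidean_space k) T" "A \<in> T \<rightarrow>\<^sub>E one_forms X"
    and s: "\<And>n U p. (n, U, p) \<in> plots X \<Longrightarrow>
      smooth_map (prod_dspace (subset_dspace (euclidean_dspace k) T)
                              (subset_dspace (euclidean_dspace n) U))
        (euclidean_dspace n) (\<lambda>(t, u). A t (n, U, p) u)"
    by (auto simp: one_forms_dspace_def)
  have "smooth_map (prod_dspace (subset_dspace (euclidean_dspace k) T)
                              (subset_dspace (euclidean_dspace n) U))
        (euclidean_dspace n) (\<lambda>(t, u). compose T (form_pullback X g) A t (n, U, p) u)"
    if p: "(n, U, p) \<in> plots X" for n U p
    by (rule smooth_map_cong[OF _ s[OF smooth_map_plots[OF g p]]])
      (auto simp: proper_prod_dspace proper_subset_dspace proper_euclidean_dspace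
        compose_def form_pullback_apply p)
  moreover have "compose T (form_pullback X g) A \<in> T \<rightarrow>\<^sub>E one_forms X"
    using A(2) form_pullback_one_forms[OF X g] by (auto simp: compose_def)
  ultimately show "(k, T, compose T (form_pullback X g) A) \<in> plots (one_forms_dspace X)"
    using A(1) by (auto simp: one_forms_dspace_def)
qed (use form_pullback_one_forms[OF X g] in \<open>simp add: one_forms_dspace_def\<close>)

text \<open>Acting on the whole class avoids choosing a representative;
  \<open>cotangent_lift_class\<close> shows that the image is again a class.\<close>

definition cotangent_lift :: "'a dspace \<Rightarrow> ('a \<Rightarrow> 'a) \<Rightarrow> ('a \<Rightarrow> 'a) \<Rightarrow> ('a \<times> 'a form) set \<Rightarrow> ('a \<times> 'a form) set"
  where "cotangent_lift X f g c = map_prod f (form_pullback X g) ` c"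

lemma cotangent_rel_iff:
  "((x, \<alpha>), (y, \<beta>)) \<in> cotangent_rel X \<longleftrightarrow> x \<in> points X \<and> y = x \<and> \<alpha> \<in> one_forms X \<and> \<beta> \<in> one_forms X \<and>
     (\<forall>n U p. (n, U, p) \<in> plots X \<longrightarrow> 0 \<in> U \<and> p 0 = x \<longrightarrow> \<alpha> (n, U, p) 0 = \<beta> (n, U, p) 0)"
  unfolding cotangent_rel_def mem_Collect_eq prod.case Ball_triple ..

lemma one_forms_extensional: "\<alpha> \<in> one_forms X \<Longrightarrow> \<alpha> \<in> extensional (plots X)"
  by (simp add: one_forms_def)

text \<open>A plot with value \<open>f x\<close> at 0 has value \<open>x\<close> at 0 after
  composition with \<open>g\<close>, so the agreement of the two forms over \<open>x\<close> gives
  that of their pullbacks over \<open>f x\<close>.\<close>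

lemma cotangent_rel_transport:
  assumes X: "diffeological_space X" and i: "dspace_iso X X f g"
    and ab: "(a, b) \<in> cotangent_rel X"
  shows "(map_prod f (form_pullback X g) a, map_prod f (form_pullback X g) b) \<in> cotangent_rel X"
proof -
  obtain x \<alpha> y \<beta> where ab': "a = (x, \<alpha>)" "b = (y, \<beta>)" by (cases a, cases b)
  note r = ab[unfolded ab' cotangent_rel_iff]
  note g = dspace_isoD(2)[OF i]
  have "form_pullback X g \<alpha> (n, U, p) 0 = form_pullback X g \<beta> (n, U, p) 0"
    if p: "(n, U, p) \<in> plots X" and 0: "0 \<in> U" "p 0 = f x" for n U p
  proof -
    have "compose U g p 0 = x" using 0 r dspace_isoD(3)[OF i] by (simp add: compose_def)
    then show ?thesis using r smooth_map_plots[OF g p] 0(1) by (simp add: form_pullback_apply p)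
  qed
  then show ?thesis
    using r dspace_isoD(5)[OF i] form_pullback_one_forms[OF X g]
    by (simp add: ab' cotangent_rel_iff)
qed

lemma cotangent_lift_Image:
  assumes X: "diffeological_space X" and i: "dspace_iso X X f g"
    and S: "S \<subseteq> points X \<times> extensional (plots X)"
  shows "cotangent_lift X f g (cotangent_rel X `` S) = cotangent_rel X `` cotangent_lift X f g S"
  unfolding cotangent_lift_def
proof (rule image_Image_transport[OF _ _ _ _ S])
  note inv = form_pullback_inverse[OF diffeological_imp_proper[OF X]]
  note i' = dspace_iso_sym[OF i]
  show "(map_prod f (form_pullback X g) a, map_prod f (form_pullback X g) b) \<in> cotangent_rel X"
    if "(a, b) \<in> cotangent_rel X" for a b by (rule cotangent_rel_transport[OF X i that])
  show "(map_prod g (form_pullback X f) a, map_prod g (form_pullback X f) b) \<in> cotangent_rel X"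
    if "(a, b) \<in> cotangent_rel X" for a b by (rule cotangent_rel_transport[OF X i' that])
  show "map_prod g (form_pullback X f) (map_prod f (form_pullback X g) a) = a"
    if "a \<in> points X \<times> extensional (plots X)" for a
    using that inv[OF i] dspace_isoD(3)[OF i] by auto
  show "map_prod f (form_pullback X g) (map_prod g (form_pullback X f) b) = b"
    if "(a, b) \<in> cotangent_rel X" for a b
    using that inv[OF i'] dspace_isoD(4)[OF i] one_forms_extensional
    by (cases a, cases b) (auto simp: cotangent_rel_iff)
qed

lemma cotangent_points:
  "points (total_space (cotangent_bundle X)) = (points X \<times> one_forms X) // cotangent_rel X"
  by (simp add: cotangent_bundle_def quotient_dspace_def one_forms_dspace_def)

text \<open>\<open>proj\<close> applies \<open>the_elem\<close> to the first components of a class,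
  so it has to be known that these form a singleton: they all equal \<open>x\<close>, and the class
  contains \<open>(x, \<alpha>)\<close>.\<close>

lemma cotangent_classE:
  assumes "c \<in> points (total_space (cotangent_bundle X))"
  obtains x \<alpha> where "x \<in> points X" "\<alpha> \<in> one_forms X" "c = cotangent_rel X `` {(x, \<alpha>)}"
    "proj (cotangent_bundle X) c = x" "c \<subseteq> {x} \<times> one_forms X"
proof -
  obtain x \<alpha> where x: "x \<in> points X" "\<alpha> \<in> one_forms X" "c = cotangent_rel X `` {(x, \<alpha>)}"
    using assms unfolding cotangent_points by (auto elim!: quotientE)
  have sub: "c \<subseteq> {x} \<times> one_forms X" using x(3) by (auto simp: cotangent_rel_iff)
  moreover have "(x, \<alpha>) \<in> c" using x by (simp add: cotangent_rel_iff)
  ultimately have "fst ` c = {x}" by force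
  then have "proj (cotangent_bundle X) c = x" by (simp add: cotangent_bundle_def)
  then show ?thesis using that x sub by blast
qed

lemma cotangent_lift_class:
  assumes X: "diffeological_space X" and i: "dspace_iso X X f g"
    and "x \<in> points X" "\<alpha> \<in> one_forms X"
  shows "cotangent_lift X f g (cotangent_rel X `` {(x, \<alpha>)}) = cotangent_rel X `` {(f x, form_pullback X g \<alpha>)}"
  using cotangent_lift_Image[OF X i, of "{(x, \<alpha>)}"] assms(3,4)
  by (simp add: cotangent_lift_def one_forms_extensional)

lemma cotangent_lift_inverse:
  assumes X: "diffeological_space X" and i: "dspace_iso X X f g"
    and c: "c \<subseteq> points X \<times> extensional (plots X)"
  shows "cotangent_lift X g f (cotangent_lift X f g c) = c"
proof -
  have "map_prod g (form_pullback X f) (map_prod f (form_pullback X g) a) = a" if "a \<in> c" for a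
    using that c form_pullback_inverse[OF diffeological_imp_proper[OF X] i] dspace_isoD(3)[OF i]
    by auto
  then show ?thesis by (simp add: cotangent_lift_def image_image)
qed

lemma proper_quotient_dspace: "proper_plots (quotient_dspace X r)"
  by (auto simp: proper_plots_def quotient_dspace_def)

lemma proper_one_forms_dspace: "proper_plots (one_forms_dspace X)"
  by (auto simp: proper_plots_def one_forms_dspace_def)

lemma quotient_dspace_plots_iff:
  "(n, U, q) \<in> plots (quotient_dspace X r) \<longleftrightarrow>
     openin (Euclidean_space n) U \<and> q \<in> U \<rightarrow>\<^sub>E points X // r \<and>
     (\<forall>u\<in>U. \<exists>V p. u \<in> V \<and> V \<subseteq> U \<and> (n, V, p) \<in> plots X \<and> (\<forall>v\<in>V. q v = r `` {p v}))"
  by (simp add: quotient_dspace_def)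

lemma cotangent_lift_smooth:
  assumes X: "diffeological_space X" and i: "dspace_iso X X f g"
  shows "smooth_map (total_space (cotangent_bundle X)) (total_space (cotangent_bundle X)) (cotangent_lift X f g)"
proof (rule smooth_mapI)
  let ?A = "prod_dspace X (one_forms_dspace X)" and ?r = "cotangent_rel X"
  have E: "total_space (cotangent_bundle X) = quotient_dspace ?A ?r"
    by (simp add: cotangent_bundle_def)
  note f = dspace_isoD(1)[OF i] and g = dspace_isoD(2)[OF i]
  show pts: "cotangent_lift X f g c \<in> points (total_space (cotangent_bundle X))"
    if c: "c \<in> points (total_space (cotangent_bundle X))" for c
  proof (rule cotangent_classE[OF c])
    fix x \<alpha> assume x: "x \<in> points X" "\<alpha> \<in> one_forms X" "c = ?r `` {(x, \<alpha>)}"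
    show ?thesis
      unfolding cotangent_points x(3) cotangent_lift_class[OF X i x(1,2)]
      by (intro quotientI) (simp add: dspace_isoD(5)[OF i x(1)] form_pullback_one_forms[OF X g x(2)])
  qed
  fix n U q assume "(n, U, q) \<in> plots (total_space (cotangent_bundle X))"
  then have q: "(n, U, q) \<in> plots (quotient_dspace ?A ?r)" by (simp only: E)
  note q' = q[unfolded quotient_dspace_plots_iff]
  have "compose U (cotangent_lift X f g) q \<in> U \<rightarrow>\<^sub>E points ?A // ?r"
    using q' pts by (auto simp: compose_def E quotient_dspace_def)
  moreover have "\<exists>V p. u \<in> V \<and> V \<subseteq> U \<and> (n, V, p) \<in> plots ?A \<and>
      (\<forall>v\<in>V. compose U (cotangent_lift X f g) q v = ?r `` {p v})" if u: "u \<in> U" for u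
  proof -
    obtain V p where V: "u \<in> V" "V \<subseteq> U" "(n, V, p) \<in> plots ?A" "\<forall>v\<in>V. q v = ?r `` {p v}"
      using q' u by blast
    \<comment> \<open>The local lift of \<open>q\<close> to the product is moved by a smooth map of
      the product, and \<open>cotangent_lift_class\<close> identifies the classes of the
      result.\<close>
    let ?p = "compose V (map_prod f (form_pullback X g)) p"
    have "(n, V, ?p) \<in> plots ?A"
      by (rule smooth_map_plots[OF smooth_map_prod[OF f form_pullback_smooth[OF X g]] V(3)])
    moreover have "compose U (cotangent_lift X f g) q v = ?r `` {?p v}" if v: "v \<in> V" for v
    proof -
      obtain x \<alpha> where pv: "p v = (x, \<alpha>)" by (cases "p v")
      have "(x, \<alpha>) \<in> points ?A"
        using proper_plotsD(4)[OF proper_prod_dspace[OF diffeological_imp_proper[OF X] proper_one_forms_dspace] V(3) v] pv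
        by simp
      then have "x \<in> points X" "\<alpha> \<in> one_forms X" by (auto simp: one_forms_dspace_def)
      from cotangent_lift_class[OF X i this] show ?thesis
        using v V(2,4) pv by (auto simp: compose_def)
    qed
    ultimately show ?thesis using V(1,2) by blast
  qed
  ultimately have "(n, U, compose U (cotangent_lift X f g) q) \<in> plots (quotient_dspace ?A ?r)"
    using q' by (simp add: quotient_dspace_plots_iff)
  then show "(n, U, compose U (cotangent_lift X f g) q) \<in> plots (total_space (cotangent_bundle X))"
    by (simp only: E)
qed

lemma cotangent_bundle_iso:
  assumes X: "diffeological_space X" and i: "dspace_iso X X f g"
  shows "bundle_iso (cotangent_bundle X) (cotangent_bundle X) f g (cotangent_lift X f g) (cotangent_lift X g f)"
proof -
  let ?F = "cotangent_bundle X" and ?r = "cotangent_rel X" and ?\<Phi> = "cotangent_lift X f g"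
  note i' = dspace_iso_sym[OF i]
  have base: "base_space ?F = X" by (simp add: cotangent_bundle_def)
  have sub: "c \<subseteq> points X \<times> extensional (plots X)" if "c \<in> points (total_space ?F)" for c
    using that by (rule cotangent_classE) (auto simp: one_forms_extensional)
  have E: "proper_plots (total_space ?F)"
    by (simp add: cotangent_bundle_def proper_quotient_dspace)
  have iso: "dspace_iso (total_space ?F) (total_space ?F) ?\<Phi> (cotangent_lift X g f)"
    unfolding dspace_iso_def
    using cotangent_lift_smooth[OF X i] cotangent_lift_smooth[OF X i']
      cotangent_lift_inverse[OF X i sub] cotangent_lift_inverse[OF X i' sub] by simp
  have pr: "proj ?F c \<in> points X \<and> proj ?F (?\<Phi> c) = f (proj ?F c)" if c: "c \<in> points (total_space ?F)" for c
  proof (rule cotangent_classE[OF c])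
    fix x \<alpha> assume x: "x \<in> points X" "\<alpha> \<in> one_forms X" "c = ?r `` {(x, \<alpha>)}" "proj ?F c = x"
    show ?thesis
    proof (rule cotangent_classE[OF dspace_isoD(5)[OF iso c]])
      fix y \<beta> assume y: "\<beta> \<in> one_forms X" "?\<Phi> c = ?r `` {(y, \<beta>)}" "y \<in> points X" "proj ?F (?\<Phi> c) = y"
      have "(y, \<beta>) \<in> ?\<Phi> c" using y by (simp add: cotangent_rel_iff)
      then have "y = f x"
        using cotangent_lift_class[OF X i x(1,2)] x(3) by (auto simp: cotangent_rel_iff)
      then show ?thesis using x y by simp
    qed
  qed
  have add: "?\<Phi> (fadd ?F c d) = fadd ?F (?\<Phi> c) (?\<Phi> d)"
    if c: "c \<in> points (total_space ?F)" and d: "d \<in> points (total_space ?F)" for c d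
  proof -
    let ?S = "\<lambda>c d. {(x, form_add X \<alpha> \<beta>) | x \<alpha> \<beta>. (x, \<alpha>) \<in> c \<and> (x, \<beta>) \<in> d}"
    have "?\<Phi> (?S c d) = ?S (?\<Phi> c) (?\<Phi> d)"
    proof
      show "?\<Phi> (?S c d) \<subseteq> ?S (?\<Phi> c) (?\<Phi> d)"
        by (force simp: cotangent_lift_def form_pullback_add[OF dspace_isoD(2)[OF i]])
      show "?S (?\<Phi> c) (?\<Phi> d) \<subseteq> ?\<Phi> (?S c d)"
      proof clarify
        fix y \<alpha>' \<beta>' assume "(y, \<alpha>') \<in> ?\<Phi> c" "(y, \<beta>') \<in> ?\<Phi> d"
        then obtain x \<alpha> z \<beta> where *: "(x, \<alpha>) \<in> c" "y = f x" "\<alpha>' = form_pullback X g \<alpha>"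
          "(z, \<beta>) \<in> d" "y = f z" "\<beta>' = form_pullback X g \<beta>"
          by (auto simp: cotangent_lift_def)
        then have "x \<in> points X" "z \<in> points X" "f x = f z" using sub[OF c] sub[OF d] by auto
        \<comment> \<open>The two representatives were only known to lie over points with the same
          image; injectivity of \<open>f\<close> puts them in one fiber, so they can be added before
          lifting.\<close>
        then have "x = z" using dspace_isoD(3)[OF i] by metis
        then have "(x, form_add X \<alpha> \<beta>) \<in> ?S c d" using * by blast
        then show "(y, form_add X \<alpha>' \<beta>') \<in> ?\<Phi> (?S c d)"
          unfolding cotangent_lift_def
          by (rule rev_image_eqI) (simp add: * form_pullback_add[OF dspace_isoD(2)[OF i]])
      qed
    qed
    moreover have "?S c d \<subseteq> points X \<times> extensional (plots X)" using sub[OF c] by auto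
    ultimately show ?thesis
      using cotangent_lift_Image[OF X i, of "?S c d"] by (simp add: cotangent_bundle_def)
  qed
  have scale: "?\<Phi> (fscale ?F r c) = fscale ?F r (?\<Phi> c)" if c: "c \<in> points (total_space ?F)" for r c
  proof -
    let ?S = "\<lambda>c. {(x, form_scale X r \<alpha>) | x \<alpha>. (x, \<alpha>) \<in> c}"
    have "?\<Phi> (?S c) = ?S (?\<Phi> c)"
      by (force simp: cotangent_lift_def form_pullback_add[OF dspace_isoD(2)[OF i]])
    moreover have "?S c \<subseteq> points X \<times> extensional (plots X)" using sub[OF c] by auto
    ultimately show ?thesis
      using cotangent_lift_Image[OF X i, of "?S c"] by (simp add: cotangent_bundle_def)
  qed
  have zero: "?\<Phi> (fzero ?F x) = fzero ?F (f x)" if "x \<in> points X" for x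
    using cotangent_lift_Image[OF X i, of "{(x, form_zero X)}"] that
    by (simp add: cotangent_bundle_def cotangent_lift_def form_pullback_add[OF dspace_isoD(2)[OF i]])
  show ?thesis
    unfolding bundle_iso_def base
    using diffeological_imp_proper[OF X] E i iso pr add scale zero by blast
qed

theorem natural_cotangent_bundle:
  assumes X: "diffeological_space X"
  shows "natural_bundle (cotangent_bundle X)"
proof -
  have base: "base_space (cotangent_bundle X) = X" by (simp add: cotangent_bundle_def)
  show ?thesis
    unfolding natural_bundle_def base
    using X cotangent_bundle_iso[OF X diffeomorphism_dspace_iso[OF diffeological_imp_proper[OF X]]]
    by (auto simp: cotangent_bundle_def proper_quotient_dspace)
qed

section \<open>The internal tangent bundle\<close>

definition push_plot :: "('a \<Rightarrow> 'a) \<Rightarrow> 'a plot \<Rightarrow> 'a plot" where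
  "push_plot f = (\<lambda>(n, U, p). (n, U, compose U f p))"

lemma push_plot_apply [simp]: "push_plot f (n, U, p) = (n, U, compose U f p)"
  by (simp add: push_plot_def)

lemma push_plot_plots: "smooth_map X X f \<Longrightarrow> q \<in> plots X \<Longrightarrow> push_plot f q \<in> plots X"
  by (cases q) (simp add: smooth_map_plots)

lemma push_plot_inverse:
  assumes X: "proper_plots X" and i: "dspace_iso X X f g" and q: "q \<in> plots X"
  shows "push_plot g (push_plot f q) = q"
proof -
  obtain n U p where q': "q = (n, U, p)" by (cases q)
  have "compose U g (compose U f p) = p"
    unfolding compose_compose
    by (rule compose_id_on) (simp_all add: proper_plotsD[OF X q[unfolded q']] dspace_isoD(3)[OF i])
  then show ?thesis by (simp add: q')
qed

lemma centered_plots_iff: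
  "(n, U, p) \<in> centered_plots X x \<longleftrightarrow>
     (n, U, p) \<in> plots X \<and> connectedin (Euclidean_space n) U \<and> 0 \<in> U \<and> p 0 = x"
  by (simp add: centered_plots_def)

lemma centered_plotsD: "q \<in> centered_plots X x \<Longrightarrow> q \<in> plots X"
  by (auto simp: centered_plots_def)

lemma push_plot_centered:
  assumes "smooth_map X X f" "q \<in> centered_plots X x"
  shows "push_plot f q \<in> centered_plots X (f x)"
  using assms smooth_map_plots by (cases q) (auto simp: centered_plots_iff compose_def)

text \<open>With \<open>g\<close> inverse to \<open>f\<close>, this moves the coefficient of a plot
  to its composite with \<open>f\<close>. The guard matters because \<open>push_plot g\<close>
  ignores values off the domain: otherwise a triple that is not extensional would inherit the
  coefficient of a genuine plot.\<close>

definition tsum_transport :: "'a dspace \<Rightarrow> ('a \<Rightarrow> 'a) \<Rightarrow> 'a tsum \<Rightarrow> 'a tsum" where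
  "tsum_transport X g \<xi> = (\<lambda>q. if q \<in> plots X then \<xi> (push_plot g q) else 0)"

lemma tsum_transport_linear:
  "tsum_transport X g (\<xi> + \<eta>) = tsum_transport X g \<xi> + tsum_transport X g \<eta>"
  "tsum_transport X g (\<xi> - \<eta>) = tsum_transport X g \<xi> - tsum_transport X g \<eta>"
  "tsum_transport X g (tsum_scale r \<xi>) = tsum_scale r (tsum_transport X g \<xi>)"
  "tsum_transport X g 0 = 0"
  by (auto simp: tsum_transport_def tsum_scale_def fun_eq_iff)

lemma tsum_transport_inj:
  assumes X: "proper_plots X" and i: "dspace_iso X X f g" and q: "q \<in> plots X"
  shows "tsum_transport X g (tsum_inj q v) = tsum_inj (push_plot f q) v"
proof
  fix q'
  have "push_plot g q' = q \<longleftrightarrow> q' = push_plot f q" if "q' \<in> plots X"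
    using push_plot_inverse[OF X i q] push_plot_inverse[OF X dspace_iso_sym[OF i] that] by auto
  moreover have "push_plot f q \<in> plots X" using push_plot_plots[OF dspace_isoD(1)[OF i] q] .
  ultimately show "tsum_transport X g (tsum_inj q v) q' = tsum_inj (push_plot f q) v q'"
    by (auto simp: tsum_transport_def tsum_inj_def)
qed

lemma tsums_iff:
  "\<xi> \<in> tsums X x \<longleftrightarrow> (\<forall>q\<in>centered_plots X x. \<xi> q \<in> Euc (fst q)) \<and>
     (\<forall>q. q \<notin> centered_plots X x \<longrightarrow> \<xi> q = 0) \<and> finite {q. \<xi> q \<noteq> 0}"
  by (simp add: tsums_def Ball_def)

lemma tsums_outside: "\<xi> \<in> tsums X x \<Longrightarrow> q \<notin> centered_plots X x \<Longrightarrow> \<xi> q = 0"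
  unfolding tsums_iff by blast

text \<open>The support condition under which the transports along \<open>f\<close> and
  \<open>g\<close> are mutually inverse. It is independent of the base point and plays the role of
  \<open>A\<close> in \<open>image_Image_transport\<close>.\<close>

definition plot_families :: "'a dspace \<Rightarrow> 'a tsum set" where
  "plot_families X = {\<xi>. \<forall>q. q \<notin> plots X \<longrightarrow> \<xi> q = 0}"

lemma plot_families_outside: "\<xi> \<in> plot_families X \<Longrightarrow> q \<notin> plots X \<Longrightarrow> \<xi> q = 0"
  unfolding plot_families_def by blast

lemma tsums_plot_families: "\<xi> \<in> tsums X x \<Longrightarrow> \<xi> \<in> plot_families X"
  unfolding plot_families_def using tsums_outside centered_plotsD by fast

lemma tsum_transport_inverse:
  assumes X: "proper_plots X" and i: "dspace_iso X X f g" and \<xi>: "\<xi> \<in> plot_families X"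
  shows "tsum_transport X f (tsum_transport X g \<xi>) = \<xi>"
proof
  fix q
  show "tsum_transport X f (tsum_transport X g \<xi>) q = \<xi> q"
  proof (cases "q \<in> plots X")
    case True
    then show ?thesis
      using push_plot_inverse[OF X i True] push_plot_plots[OF dspace_isoD(1)[OF i] True]
      by (simp add: tsum_transport_def)
  next
    case False
    then show ?thesis using plot_families_outside[OF \<xi>] by (simp add: tsum_transport_def)
  qed
qed

lemma tsum_transport_tsums:
  assumes X: "proper_plots X" and i: "dspace_iso X X f g" and x: "x \<in> points X"
    and \<xi>: "\<xi> \<in> tsums X x"
  shows "tsum_transport X g \<xi> \<in> tsums X (f x)"
  unfolding tsums_iff
proof (intro conjI ballI allI impI)
  fix q assume "q \<in> centered_plots X (f x)"
  then have "push_plot g q \<in> centered_plots X x"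
    using push_plot_centered[OF dspace_isoD(2)[OF i]] dspace_isoD(3)[OF i x] by metis
  moreover have "fst (push_plot g q) = fst q" by (cases q) simp
  ultimately show "tsum_transport X g \<xi> q \<in> Euc (fst q)"
    using \<xi> by (auto simp: tsums_iff tsum_transport_def topspace_Euclidean_space)
next
  note fg = push_plot_inverse[OF X dspace_iso_sym[OF i]]
  fix q assume q: "q \<notin> centered_plots X (f x)"
  show "tsum_transport X g \<xi> q = 0"
  proof (cases "q \<in> plots X")
    case True
    then have "push_plot g q \<notin> centered_plots X x"
      using push_plot_centered[OF dspace_isoD(1)[OF i], of "push_plot g q" x] fg q by auto
    then show ?thesis using tsums_outside[OF \<xi>] by (simp add: tsum_transport_def)
  qed (simp add: tsum_transport_def)
next
  note fg = push_plot_inverse[OF X dspace_iso_sym[OF i]]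
  have "{q. tsum_transport X g \<xi> q \<noteq> 0} \<subseteq> push_plot f ` {q. \<xi> q \<noteq> 0}"
  proof
    fix q assume "q \<in> {q. tsum_transport X g \<xi> q \<noteq> 0}"
    then have "q \<in> plots X" "\<xi> (push_plot g q) \<noteq> 0" by (auto simp: tsum_transport_def split: if_splits)
    then show "q \<in> push_plot f ` {q. \<xi> q \<noteq> 0}" using fg by (intro image_eqI[of _ _ "push_plot g q"]) auto
  qed
  then show "finite {q. tsum_transport X g \<xi> q \<noteq> 0}"
    using \<xi> by (auto simp: tsums_iff intro: finite_subset)
qed

text \<open>Opens the theory of \<open>module.span\<close> to the relation that defines the
  colimit.\<close>

lemma module_tsum_scale: "module (tsum_scale :: real \<Rightarrow> 'a tsum \<Rightarrow> 'a tsum)"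
  by unfold_locales (auto simp: tsum_scale_def fun_eq_iff algebra_simps)

text \<open>Applying \<open>f\<close> to both sides of the arrow equation shows that the same
  \<open>h\<close> on the same \<open>W\<close> is an arrow between the pushed plots, so its
  differential at 0 does not change.\<close>

lemma tsum_transport_arrow_relations:
  assumes X: "proper_plots X" and i: "dspace_iso X X f g" and \<rho>: "\<rho> \<in> arrow_relations X x"
  shows "tsum_transport X g \<rho> \<in> arrow_relations X (f x)"
proof -
  obtain q q' W h v where r: "\<rho> = tsum_inj q v - tsum_inj q' (differential (fst q) (fst q') h 0 v)"
    "q \<in> centered_plots X x" "q' \<in> centered_plots X x" "arrow_representative q q' W h" "v \<in> Euc (fst q)"
    using \<rho> unfolding arrow_relations_def by blast
  have pl: "q \<in> plots X" "q' \<in> plots X" using centered_plotsD[OF r(2)] centered_plotsD[OF r(3)] .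
  obtain n U p m U' p' where q: "q = (n, U, p)" and q': "q' = (m, U', p')" by (cases q, cases q')
  have "arrow_representative (push_plot f q) (push_plot f q') W h"
    using r(4) unfolding q q' arrow_representative_def
    by (auto simp: compose_def smooth_euc_def)
  moreover have "tsum_transport X g \<rho> =
      tsum_inj (push_plot f q) v - tsum_inj (push_plot f q') (differential (fst (push_plot f q)) (fst (push_plot f q')) h 0 v)"
    unfolding r(1) tsum_transport_linear tsum_transport_inj[OF X i pl(1)] tsum_transport_inj[OF X i pl(2)]
    by (simp add: q q')
  moreover have "v \<in> Euc (fst (push_plot f q))" using r(5) by (simp add: q)
  ultimately show ?thesis
    unfolding arrow_relations_def
    using push_plot_centered[OF dspace_isoD(1)[OF i] r(2)] push_plot_centered[OF dspace_isoD(1)[OF i] r(3)]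
    by blast
qed

lemma tsum_transport_span:
  assumes X: "proper_plots X" and i: "dspace_iso X X f g"
    and \<xi>: "\<xi> \<in> module.span tsum_scale (arrow_relations X x)"
  shows "tsum_transport X g \<xi> \<in> module.span tsum_scale (arrow_relations X (f x))"
proof -
  interpret module "tsum_scale :: real \<Rightarrow> 'a tsum \<Rightarrow> 'a tsum" by (rule module_tsum_scale)
  show ?thesis
    using \<xi>
  proof (induction rule: span_induct_alt)
    case base
    then show ?case by (simp only: tsum_transport_linear span_zero)
  next
    case (step c a b)
    have "tsum_transport X g a \<in> arrow_relations X (f x)"
      using tsum_transport_arrow_relations[OF X i step(1)] .
    then show ?case
      using step by (simp only: tsum_transport_linear span_add span_scale span_base)
  qed
qed

lemma tangent_rel_iff:
  "(\<xi>, \<eta>) \<in> tangent_rel X x \<longleftrightarrow> \<xi> \<in> tsums X x \<and> \<eta> \<in> tsums X x \<and>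
     \<xi> - \<eta> \<in> module.span tsum_scale (arrow_relations X x)"
  by (simp add: tangent_rel_def)

lemma tsum_transport_tangent_rel:
  assumes X: "proper_plots X" and i: "dspace_iso X X f g" and x: "x \<in> points X"
    and r: "(\<xi>, \<eta>) \<in> tangent_rel X x"
  shows "(tsum_transport X g \<xi>, tsum_transport X g \<eta>) \<in> tangent_rel X (f x)"
  using r tsum_transport_tsums[OF X i x] tsum_transport_span[OF X i, of "\<xi> - \<eta>"]
  by (simp add: tangent_rel_iff tsum_transport_linear)

lemma tsum_transport_Image:
  assumes X: "proper_plots X" and i: "dspace_iso X X f g" and x: "x \<in> points X"
    and S: "S \<subseteq> plot_families X"
  shows "tsum_transport X g ` (tangent_rel X x `` S) = tangent_rel X (f x) `` (tsum_transport X g ` S)"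
proof (rule image_Image_transport[OF _ _ _ _ S])
  note i' = dspace_iso_sym[OF i]
  show "(tsum_transport X g a, tsum_transport X g b) \<in> tangent_rel X (f x)"
    if "(a, b) \<in> tangent_rel X x" for a b by (rule tsum_transport_tangent_rel[OF X i x that])
  show "(tsum_transport X f a, tsum_transport X f b) \<in> tangent_rel X x"
    if "(a, b) \<in> tangent_rel X (f x)" for a b
    using tsum_transport_tangent_rel[OF X i' dspace_isoD(5)[OF i x] that] dspace_isoD(3)[OF i x] by simp
  show "tsum_transport X f (tsum_transport X g a) = a" if "a \<in> plot_families X" for a
    by (rule tsum_transport_inverse[OF X i that])
  show "tsum_transport X g (tsum_transport X f b) = b" if "(a, b) \<in> tangent_rel X (f x)" for a b
    by (rule tsum_transport_inverse[OF X i'], rule tsums_plot_families[where x = "f x"]) (use that in \<open>simp add: tangent_rel_iff\<close>)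
qed

section \<open>Vector operations on tangent classes\<close>

lemma tsums_zero: "0 \<in> tsums X x"
  by (auto simp: tsums_iff topspace_Euclidean_space)

lemma tsums_add:
  assumes "\<xi> \<in> tsums X x" "\<eta> \<in> tsums X x"
  shows "\<xi> + \<eta> \<in> tsums X x"
proof -
  have "finite ({q. \<xi> q \<noteq> 0} \<union> {q. \<eta> q \<noteq> 0})" using assms by (simp add: tsums_iff)
  then have "finite {q. (\<xi> + \<eta>) q \<noteq> 0}" by (rule rev_finite_subset) auto
  then show ?thesis using assms by (auto simp: tsums_iff topspace_Euclidean_space)
qed

lemma tsums_scale:
  assumes "\<xi> \<in> tsums X x"
  shows "tsum_scale r \<xi> \<in> tsums X x"
proof -
  have "finite {q. \<xi> q \<noteq> 0}" using assms by (simp add: tsums_iff)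
  then have "finite {q. tsum_scale r \<xi> q \<noteq> 0}"
    by (rule rev_finite_subset) (auto simp: tsum_scale_def fun_eq_iff)
  then show ?thesis
    using assms by (auto simp: tsums_iff topspace_Euclidean_space tsum_scale_def fun_eq_iff)
qed

lemma tsum_inj_tsums:
  assumes "q \<in> centered_plots X x" "v \<in> Euc (fst q)"
  shows "tsum_inj q v \<in> tsums X x"
proof -
  have "{q'. tsum_inj q v q' \<noteq> 0} \<subseteq> {q}" by (auto simp: tsum_inj_def)
  then have "finite {q'. tsum_inj q v q' \<noteq> 0}" using finite_subset by blast
  then show ?thesis using assms by (auto simp: tsums_iff tsum_inj_def topspace_Euclidean_space)
qed

lemma tangent_rel_refl: "\<xi> \<in> tsums X x \<Longrightarrow> (\<xi>, \<xi>) \<in> tangent_rel X x"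
proof -
  interpret module "tsum_scale :: real \<Rightarrow> 'a tsum \<Rightarrow> 'a tsum" by (rule module_tsum_scale)
  show "\<xi> \<in> tsums X x \<Longrightarrow> (\<xi>, \<xi>) \<in> tangent_rel X x" by (simp add: tangent_rel_iff span_zero)
qed

lemma tangent_rel_trans:
  assumes "(\<xi>, \<eta>) \<in> tangent_rel X x" "(\<eta>, \<zeta>) \<in> tangent_rel X x"
  shows "(\<xi>, \<zeta>) \<in> tangent_rel X x"
proof -
  interpret module "tsum_scale :: real \<Rightarrow> 'a tsum \<Rightarrow> 'a tsum" by (rule module_tsum_scale)
  have "(\<xi> - \<eta>) + (\<eta> - \<zeta>) \<in> span (arrow_relations X x)"
    using assms by (intro span_add) (auto simp: tangent_rel_iff)
  then show ?thesis using assms by (simp add: tangent_rel_iff)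
qed

lemma tangent_rel_add:
  assumes "(\<xi>, \<xi>') \<in> tangent_rel X x" "(\<eta>, \<eta>') \<in> tangent_rel X x"
  shows "(\<xi> + \<eta>, \<xi>' + \<eta>') \<in> tangent_rel X x"
proof -
  interpret module "tsum_scale :: real \<Rightarrow> 'a tsum \<Rightarrow> 'a tsum" by (rule module_tsum_scale)
  have "(\<xi> - \<xi>') + (\<eta> - \<eta>') \<in> span (arrow_relations X x)"
    using assms by (intro span_add) (auto simp: tangent_rel_iff)
  then show ?thesis using assms by (simp add: tangent_rel_iff tsums_add algebra_simps)
qed

lemma tangent_rel_scale:
  assumes "(\<xi>, \<xi>') \<in> tangent_rel X x"
  shows "(tsum_scale r \<xi>, tsum_scale r \<xi>') \<in> tangent_rel X x"
proof -
  interpret module "tsum_scale :: real \<Rightarrow> 'a tsum \<Rightarrow> 'a tsum" by (rule module_tsum_scale)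
  have "tsum_scale r (\<xi> - \<xi>') \<in> span (arrow_relations X x)"
    using assms by (intro span_scale) (auto simp: tangent_rel_iff)
  then show ?thesis using assms by (simp add: tangent_rel_iff tsums_scale scale_right_diff_distrib)
qed

text \<open>Expresses that an operation formed from all representatives is well defined: if the
  results are all equivalent to one of them, transitivity makes their saturation a single
  class.\<close>

lemma tangent_rel_Image_eq:
  assumes "\<xi> \<in> S" "\<And>\<eta>. \<eta> \<in> S \<Longrightarrow> (\<xi>, \<eta>) \<in> tangent_rel X x"
  shows "tangent_rel X x `` S = tangent_rel X x `` {\<xi>}"
proof (intro subset_antisym subsetI)
  fix \<zeta> assume "\<zeta> \<in> tangent_rel X x `` S"
  then obtain \<eta> where "\<eta> \<in> S" "(\<eta>, \<zeta>) \<in> tangent_rel X x" by auto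
  then show "\<zeta> \<in> tangent_rel X x `` {\<xi>}" using tangent_rel_trans[OF assms(2)] by simp
qed (use assms(1) in auto)

lemma tangent_points_iff:
  "(x, c) \<in> internal_tangent_points X \<longleftrightarrow> x \<in> points X \<and> (\<exists>\<xi>\<in>tsums X x. c = tangent_rel X x `` {\<xi>})"
  by (auto simp: internal_tangent_points_def quotient_def)

lemma tangent_class_subset: "(x, c) \<in> internal_tangent_points X \<Longrightarrow> c \<subseteq> plot_families X"
  using tsums_plot_families by (fastforce simp: tangent_points_iff tangent_rel_iff)

lemma tangent_add_points:
  assumes "(x, c) \<in> internal_tangent_points X" "(x, d) \<in> internal_tangent_points X"
  shows "(x, tangent_rel X x `` {\<xi> + \<eta> | \<xi> \<eta>. \<xi> \<in> c \<and> \<eta> \<in> d}) \<in> internal_tangent_points X"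
proof -
  obtain \<xi> \<eta> where x: "x \<in> points X" "\<xi> \<in> tsums X x" "\<eta> \<in> tsums X x"
    "c = tangent_rel X x `` {\<xi>}" "d = tangent_rel X x `` {\<eta>}"
    using assms by (auto simp: tangent_points_iff)
  have "\<xi> \<in> c" "\<eta> \<in> d" using x tangent_rel_refl by auto
  then have "tangent_rel X x `` {\<xi> + \<eta> | \<xi> \<eta>. \<xi> \<in> c \<and> \<eta> \<in> d} = tangent_rel X x `` {\<xi> + \<eta>}"
    by (intro tangent_rel_Image_eq) (auto simp: x(4,5) intro: tangent_rel_add)
  then show ?thesis using x(1) tsums_add[OF x(2,3)] by (auto simp: tangent_points_iff)
qed

lemma tangent_scale_points:
  assumes "(x, c) \<in> internal_tangent_points X"
  shows "(x, tangent_rel X x `` {tsum_scale r \<xi> | \<xi>. \<xi> \<in> c}) \<in> internal_tangent_points X"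
proof -
  obtain \<xi> where x: "x \<in> points X" "\<xi> \<in> tsums X x" "c = tangent_rel X x `` {\<xi>}"
    using assms by (auto simp: tangent_points_iff)
  have "\<xi> \<in> c" using x tangent_rel_refl by auto
  then have "tangent_rel X x `` {tsum_scale r \<xi> | \<xi>. \<xi> \<in> c} = tangent_rel X x `` {tsum_scale r \<xi>}"
    by (intro tangent_rel_Image_eq) (auto simp: x(3) intro: tangent_rel_scale)
  then show ?thesis using x(1) tsums_scale[OF x(2)] by (auto simp: tangent_points_iff)
qed

section \<open>The lift of a diffeomorphism to tangent classes\<close>

definition tangent_lift ::
  "'a dspace \<Rightarrow> ('a \<Rightarrow> 'a) \<Rightarrow> ('a \<Rightarrow> 'a) \<Rightarrow> 'a \<times> 'a tsum set \<Rightarrow> 'a \<times> 'a tsum set" where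
  "tangent_lift X f g = map_prod f ((`) (tsum_transport X g))"

lemma tangent_lift_points:
  assumes X: "proper_plots X" and i: "dspace_iso X X f g" and e: "e \<in> internal_tangent_points X"
  shows "tangent_lift X f g e \<in> internal_tangent_points X"
proof -
  obtain x c where xc: "e = (x, c)" by (cases e)
  then obtain \<xi> where x: "x \<in> points X" "\<xi> \<in> tsums X x" "c = tangent_rel X x `` {\<xi>}"
    using e by (auto simp: tangent_points_iff)
  have "tsum_transport X g ` c = tangent_rel X (f x) `` {tsum_transport X g \<xi>}"
    using tsum_transport_Image[OF X i x(1), of "{\<xi>}"] tsums_plot_families[OF x(2)] by (simp add: x(3))
  then show ?thesis
    using tsum_transport_tsums[OF X i x(1,2)] dspace_isoD(5)[OF i x(1)]
    by (auto simp: xc tangent_lift_def tangent_points_iff)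
qed

lemma tangent_lift_inverse:
  assumes X: "proper_plots X" and i: "dspace_iso X X f g" and e: "e \<in> internal_tangent_points X"
  shows "tangent_lift X g f (tangent_lift X f g e) = e"
proof -
  obtain x c where xc: "e = (x, c)" by (cases e)
  have "tsum_transport X f (tsum_transport X g \<xi>) = \<xi>" if "\<xi> \<in> c" for \<xi>
    by (rule tsum_transport_inverse[OF X i subsetD[OF tangent_class_subset[OF e[unfolded xc]] that]])
  then have "tsum_transport X f ` tsum_transport X g ` c = c" by (simp add: image_image)
  then show ?thesis
    using e dspace_isoD(3)[OF i] by (auto simp: xc tangent_lift_def tangent_points_iff)
qed

lemma internal_tangent_with_simps [simp]:
  "base_space (internal_tangent_with X D) = X"
  "points (total_space (internal_tangent_with X D)) = internal_tangent_points X"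
  "plots (total_space (internal_tangent_with X D)) = D"
  "proj (internal_tangent_with X D) = fst"
  by (simp_all add: internal_tangent_with_def)

text \<open>The diffeologies \<open>D\<close> and \<open>D'\<close> are kept apart because the lemma
  is used twice: between an admissible diffeology and its pullback, and with both equal to the
  smallest one.\<close>

lemma tangent_bundle_iso:
  assumes X: "proper_plots X" and i: "dspace_iso X X f g"
    and E: "proper_plots (total_space (internal_tangent_with X D))"
      "proper_plots (total_space (internal_tangent_with X D'))"
    and I: "dspace_iso (total_space (internal_tangent_with X D)) (total_space (internal_tangent_with X D'))
      (tangent_lift X f g) (tangent_lift X g f)"
  shows "bundle_iso (internal_tangent_with X D) (internal_tangent_with X D') f g
    (tangent_lift X f g) (tangent_lift X g f)"
proof -
  let ?F = "internal_tangent_with X D" and ?F' = "internal_tangent_with X D'"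
  let ?\<Phi> = "tangent_lift X f g" and ?T = "tsum_transport X g"
  have add: "?\<Phi> (fadd ?F a b) = fadd ?F' (?\<Phi> a) (?\<Phi> b)"
    if ab: "a \<in> internal_tangent_points X" "b \<in> internal_tangent_points X" "fst a = fst b" for a b
  proof -
    obtain x c d where xc: "a = (x, c)" "b = (x, d)" using ab(3) by (cases a, cases b) simp
    let ?S = "\<lambda>c d. {\<xi> + \<eta> | \<xi> \<eta>. \<xi> \<in> c \<and> \<eta> \<in> d} :: 'a tsum set"
    have x: "x \<in> points X" using ab(1) by (simp add: xc tangent_points_iff)
    note cd = tangent_class_subset[OF ab(1)[unfolded xc]] tangent_class_subset[OF ab(2)[unfolded xc]]
    have "?S c d \<subseteq> plot_families X"
    proof clarify
      fix \<xi> \<eta> assume "\<xi> \<in> c" "\<eta> \<in> d"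
      then have "\<xi> \<in> plot_families X" "\<eta> \<in> plot_families X" using cd by auto
      then show "\<xi> + \<eta> \<in> plot_families X" by (simp add: plot_families_def)
    qed
    moreover have "?T ` ?S c d = ?S (?T ` c) (?T ` d)"
    proof
      show "?T ` ?S c d \<subseteq> ?S (?T ` c) (?T ` d)" by (auto simp: tsum_transport_linear) blast
      show "?S (?T ` c) (?T ` d) \<subseteq> ?T ` ?S c d"
      proof clarify
        fix \<xi> \<eta> assume "\<xi> \<in> c" "\<eta> \<in> d"
        then have "\<xi> + \<eta> \<in> ?S c d" by blast
        then show "?T \<xi> + ?T \<eta> \<in> ?T ` ?S c d"
          by (rule rev_image_eqI) (simp add: tsum_transport_linear)
      qed
    qed
    ultimately show ?thesis
      using tsum_transport_Image[OF X i x, of "?S c d"]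
      by (simp add: xc tangent_lift_def internal_tangent_with_def)
  qed
  have scale: "?\<Phi> (fscale ?F r a) = fscale ?F' r (?\<Phi> a)" if a: "a \<in> internal_tangent_points X" for r a
  proof -
    obtain x c where xc: "a = (x, c)" by (cases a)
    let ?S = "\<lambda>c. {tsum_scale r \<xi> | \<xi>. \<xi> \<in> c} :: 'a tsum set"
    have x: "x \<in> points X" using a by (simp add: xc tangent_points_iff)
    have "?S c \<subseteq> plot_families X"
    proof clarify
      fix \<xi> assume "\<xi> \<in> c"
      then have "\<xi> \<in> plot_families X" using tangent_class_subset[OF a[unfolded xc]] by auto
      then show "tsum_scale r \<xi> \<in> plot_families X"
        by (simp add: plot_families_def tsum_scale_def fun_eq_iff)
    qed
    moreover have "?T ` ?S c = ?S (?T ` c)"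
      by (simp add: Setcompr_eq_image image_image tsum_transport_linear)
    ultimately show ?thesis
      using tsum_transport_Image[OF X i x, of "?S c"]
      by (simp add: xc tangent_lift_def internal_tangent_with_def)
  qed
  have zero: "?\<Phi> (fzero ?F x) = fzero ?F' (f x)" if "x \<in> points X" for x
    using tsum_transport_Image[OF X i that, of "{0}"]
    by (simp add: tangent_lift_def internal_tangent_with_def plot_families_def tsum_transport_linear)
  have pr: "fst e \<in> points X \<and> fst (?\<Phi> e) = f (fst e)" if "e \<in> internal_tangent_points X" for e
    using that by (cases e) (simp add: tangent_points_iff tangent_lift_def)
  show ?thesis
    unfolding bundle_iso_def internal_tangent_with_simps
    using X E i I add scale zero pr by blast
qed

section \<open>Recentered plots and the natural maps\<close>

lemma recenter_plot_centered:
  assumes X: "diffeological_space X" and q: "(n, U, p) \<in> plots X" and u: "u \<in> U"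
  shows "recenter_plot (n, U, p) u \<in> centered_plots X (p u)"
proof -
  let ?S = "{w. u + w \<in> U}"
  let ?W = "connected_component_of_set (subtopology (Euclidean_space n) ?S) 0"
  have U: "openin (Euclidean_space n) U" using proper_plotsD(1)[OF diffeological_imp_proper[OF X] q] .
  then have uE: "u \<in> Euc n" using u openin_subset by blast
  have cont: "continuous_map (Euclidean_space n) (Euclidean_space n) (\<lambda>w i. u i + w i)"
    using uE by (intro continuous_map_Euclidean_space_add) simp_all
  have "openin (Euclidean_space n) {w \<in> Euc n. (\<lambda>i. u i + w i) \<in> U}"
    by (rule openin_continuous_map_preimage[OF cont U])
  then have S: "openin (Euclidean_space n) (Euc n \<inter> ?S)"
    by (simp add: plus_fun_def Int_def)
  have 0: "0 \<in> Euc n \<inter> ?S" using u by (simp add: topspace_Euclidean_space)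
  have sub: "?W \<subseteq> Euc n \<inter> ?S"
    using connected_component_of_subset_topspace[of "subtopology (Euclidean_space n) ?S" 0] by simp
  have W0: "0 \<in> ?W" using 0 by (simp add: connected_component_of_refl)
  \<comment> \<open>Local connectedness of Euclidean space makes the component of 0 open, as the
    domain of a plot must be.\<close>
  have "openin (Euclidean_space n) (connected_component_of_set (subtopology (Euclidean_space n) (Euc n \<inter> ?S)) 0)"
    using locally_connected_B[OF locally_connected_Euclidean_space] S 0 by blast
  then have W: "openin (Euclidean_space n) ?W"
    by (simp add: subtopology_restrict)
  have conn: "connectedin (Euclidean_space n) ?W"
    using connectedin_connected_component_of[of "subtopology (Euclidean_space n) ?S" 0]
    by (simp add: connectedin_subtopology)
  have "smooth_euc n ?W n U (\<lambda>w. u + w)"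
    using sub openin_subset[OF U] by (intro smooth_euc_translation) auto
  from diffeological_reparametrize[OF X q W this]
  have "(n, ?W, \<lambda>w\<in>?W. p (u + w)) \<in> plots X" by (simp add: compose_def)
  then show ?thesis
    using W0 conn by (simp add: recenter_plot_def centered_plots_iff Let_def)
qed

text \<open>Pushing a plot changes its values but not its domain, so both sides use the same
  connected component.\<close>

lemma recenter_push_plot:
  "recenter_plot (push_plot f (n, U, p)) u = push_plot f (recenter_plot (n, U, p) u)"
proof -
  let ?S = "{w. u + w \<in> U}"
  let ?W = "connected_component_of_set (subtopology (Euclidean_space n) ?S) 0"
  have "?W \<subseteq> ?S"
    using connected_component_of_subset_topspace[of "subtopology (Euclidean_space n) ?S" 0] by simp
  then have "(\<lambda>w\<in>?W. compose U f p (u + w)) = compose ?W f (\<lambda>w\<in>?W. p (u + w))"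
    by (auto simp: compose_def fun_eq_iff)
  then show ?thesis by (simp add: recenter_plot_def Let_def)
qed

lemma natural_map_apply:
  "natural_map X (n, U, p) (u, v) = (p u, tangent_rel X (p u) `` {tsum_inj (recenter_plot (n, U, p) u) v})"
  by (simp add: natural_map_def)

lemma natural_map_points:
  assumes X: "diffeological_space X" and q: "(n, U, p) \<in> plots X" and u: "u \<in> U" "v \<in> Euc n"
  shows "natural_map X (n, U, p) (u, v) \<in> internal_tangent_points X"
proof -
  have "fst (recenter_plot (n, U, p) u) = n" by (simp add: recenter_plot_def Let_def)
  then have "tsum_inj (recenter_plot (n, U, p) u) v \<in> tsums X (p u)"
    using tsum_inj_tsums[OF recenter_plot_centered[OF X q u(1)]] u(2) by simp
  moreover have "p u \<in> points X" using proper_plotsD(4)[OF diffeological_imp_proper[OF X] q u(1)] .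
  ultimately show ?thesis by (auto simp: natural_map_apply tangent_points_iff)
qed

text \<open>Naturality of the map from the tangent bundle of a plot domain: recentering commutes
  with pushing, and transport takes the summand of a plot to that of the pushed plot. This is how
  the lift meets the generators of the tangent diffeology.\<close>

lemma natural_map_push_plot:
  assumes X: "diffeological_space X" and i: "dspace_iso X X f g"
    and q: "(n, U, p) \<in> plots X" and u: "u \<in> U"
  shows "natural_map X (push_plot f (n, U, p)) (u, v) = tangent_lift X f g (natural_map X (n, U, p) (u, v))"
proof -
  note X' = diffeological_imp_proper[OF X]
  let ?q = "recenter_plot (n, U, p) u"
  have pu: "p u \<in> points X" using proper_plotsD(4)[OF X' q u] .
  have rq: "?q \<in> plots X" using centered_plotsD[OF recenter_plot_centered[OF X q u]] .
  then have "{tsum_inj ?q v} \<subseteq> plot_families X" by (auto simp: plot_families_def tsum_inj_def)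
  from tsum_transport_Image[OF X' i pu this] show ?thesis
    using u recenter_push_plot[of f n U p u]
    by (simp add: natural_map_apply tangent_lift_def tsum_transport_inj[OF X' i rq] compose_def)
qed

section \<open>Admissible diffeologies on the tangent classes\<close>

lemma smooth_map_indiscrete:
  assumes "proper_plots Y" "\<And>y. y \<in> points Y \<Longrightarrow> f y \<in> S"
  shows "smooth_map Y \<lparr>points = S, plots = {(n, U, p). openin (Euclidean_space n) U \<and> p \<in> U \<rightarrow>\<^sub>E S}\<rparr> f"
proof (rule smooth_mapI)
  fix n U p assume p: "(n, U, p) \<in> plots Y"
  show "(n, U, compose U f p) \<in> plots \<lparr>points = S, plots = {(n, U, p). openin (Euclidean_space n) U \<and> p \<in> U \<rightarrow>\<^sub>E S}\<rparr>"
    using proper_plotsD[OF assms(1) p] assms(2) by (auto simp: compose_def)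
qed (use assms(2) in simp)

lemma diffeological_indiscrete:
  "diffeological_space \<lparr>points = S, plots = {(n, U, p). openin (Euclidean_space n) U \<and> p \<in> U \<rightarrow>\<^sub>E S}\<rparr>"
  unfolding diffeological_space_iff by (auto simp: compose_def smooth_euc_def Pi_iff)

text \<open>
  Without an admissible diffeology the intersection defining the internal tangent bundle would
  be \<open>UNIV\<close>, and its elements would not be parametrizations at all.
\<close>

lemma admissible_indiscrete:
  assumes X: "diffeological_space X"
  shows "admissible_tangent_diffeology X
    {(n, U, p). openin (Euclidean_space n) U \<and> p \<in> U \<rightarrow>\<^sub>E internal_tangent_points X}"
    (is "admissible_tangent_diffeology X ?D")
proof -
  let ?F = "internal_tangent_with X ?D"
  let ?E = "\<lparr>points = internal_tangent_points X, plots = ?D\<rparr>"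
  note X' = diffeological_imp_proper[OF X]
  have E: "total_space ?F = ?E" by (simp add: internal_tangent_with_def)
  have pE: "proper_plots ?E" using diffeological_imp_proper[OF diffeological_indiscrete] .
  note sm = smooth_map_indiscrete[where S = "internal_tangent_points X"]
  have nat: "smooth_map (prod_dspace (subset_dspace (euclidean_dspace n) U) (euclidean_dspace n)) ?E
      (natural_map X (n, U, p))" if q: "(n, U, p) \<in> plots X" for n U p
  proof (rule sm)
    show "proper_plots (prod_dspace (subset_dspace (euclidean_dspace n) U) (euclidean_dspace n))"
      by (simp add: proper_prod_dspace proper_subset_dspace proper_euclidean_dspace)
  qed (auto intro: natural_map_points[OF X q] simp: euclidean_dspace_def)
  have add: "smooth_map (subset_dspace (prod_dspace ?E ?E) {(a, b). fst a = fst b}) ?E (\<lambda>(a, b). fadd ?F a b)"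
    by (rule sm) (auto simp: proper_subset_dspace proper_prod_dspace pE internal_tangent_with_def
        intro: tangent_add_points)
  have scale: "smooth_map (prod_dspace real_dspace ?E) ?E (\<lambda>(r, a). fscale ?F r a)"
    by (rule sm) (auto simp: proper_real_dspace proper_prod_dspace pE internal_tangent_with_def
        intro: tangent_scale_points)
  have zero: "smooth_map X ?E (fzero ?F)"
    by (rule sm[OF X']) (auto simp: internal_tangent_with_def tangent_points_iff intro: tsums_zero)
  show ?thesis
    unfolding admissible_tangent_diffeology_def Let_def E Ball_triple smooth_fiberwise_operations_def
      internal_tangent_with_simps
    using diffeological_indiscrete nat add scale zero by blast
qed

lemma admissibleD:
  assumes "admissible_tangent_diffeology X D"
  shows "diffeological_space (total_space (internal_tangent_with X D))"
    "\<And>n U p. (n, U, p) \<in> plots X \<Longrightarrow>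
      smooth_map (prod_dspace (subset_dspace (euclidean_dspace n) U) (euclidean_dspace n))
        (total_space (internal_tangent_with X D)) (natural_map X (n, U, p))"
    "smooth_fiberwise_operations (internal_tangent_with X D)"
    "smooth_map X (total_space (internal_tangent_with X D)) (fzero (internal_tangent_with X D))"
  using assms unfolding admissible_tangent_diffeology_def Let_def Ball_triple by simp_all

text \<open>
  This makes the lift smooth for the smallest admissible diffeology, since each admissible \<open>D\<close>
  contains the image of the smallest one.
\<close>

lemma admissible_pullback:
  assumes X: "diffeological_space X" and i: "dspace_iso X X f g"
    and D: "admissible_tangent_diffeology X D"
  shows "admissible_tangent_diffeology X
    {(n, U, p). openin (Euclidean_space n) U \<and> p \<in> U \<rightarrow>\<^sub>E internal_tangent_points X \<and>
       (n, U, compose U (tangent_lift X f g) p) \<in> D}"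
    (is "admissible_tangent_diffeology X ?D'")
proof -
  let ?F = "internal_tangent_with X D" and ?F' = "internal_tangent_with X ?D'"
  let ?\<Phi> = "tangent_lift X f g" and ?\<Psi> = "tangent_lift X g f"
  note X' = diffeological_imp_proper[OF X]
  note i' = dspace_iso_sym[OF i]
  note A = admissibleD[OF D]
  have E: "proper_plots (total_space ?F)" by (rule diffeological_imp_proper[OF A(1)])
  have E': "proper_plots (total_space ?F')" by (auto simp: proper_plots_def)
  have "smooth_map (total_space ?F') (total_space ?F) ?\<Phi>"
    by (rule smooth_mapI) (auto simp: tangent_lift_points[OF X' i])
  moreover have "smooth_map (total_space ?F) (total_space ?F') ?\<Psi>"
  proof (rule smooth_mapI)
    fix n U p assume p: "(n, U, p) \<in> plots (total_space ?F)"
    note P = proper_plotsD[OF E p]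
    have "compose U ?\<Phi> (compose U ?\<Psi> p) = p"
      unfolding compose_compose
      by (rule compose_id_on) (use P tangent_lift_inverse[OF X' i'] in auto)
    moreover have "compose U ?\<Psi> p \<in> U \<rightarrow>\<^sub>E internal_tangent_points X"
      using P tangent_lift_points[OF X' i'] by (auto simp: compose_def)
    ultimately show "(n, U, compose U ?\<Psi> p) \<in> plots (total_space ?F')"
      using P(1) p by simp
  qed (simp add: tangent_lift_points[OF X' i'])
  ultimately have I: "dspace_iso (total_space ?F) (total_space ?F') ?\<Psi> ?\<Phi>"
    unfolding dspace_iso_def using tangent_lift_inverse[OF X' i] tangent_lift_inverse[OF X' i'] by simp
  \<comment> \<open>Read from \<open>D\<close> to the pulled-back diffeology, the isomorphism is the
    lift of the inverse and covers \<open>g\<close>. The operations and the zero section of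
    \<open>D\<close> are carried along it.\<close>
  have B: "bundle_iso ?F ?F' g f ?\<Psi> ?\<Phi>" by (rule tangent_bundle_iso[OF X' i' E E' I])
  have zero: "smooth_map X (total_space ?F') (fzero ?F')"
    by (rule smooth_map_transfer[OF i' I X' A(4)]) (use bundle_isoD(11)[OF B] in simp)
  have nat: "smooth_map (prod_dspace (subset_dspace (euclidean_dspace n) U) (euclidean_dspace n))
      (total_space ?F') (natural_map X (n, U, p))" if q: "(n, U, p) \<in> plots X" for n U p
  proof -
    let ?P = "prod_dspace (subset_dspace (euclidean_dspace n) U) (euclidean_dspace n)"
    have P: "proper_plots ?P"
      by (simp add: proper_prod_dspace proper_subset_dspace proper_euclidean_dspace)
    \<comment> \<open>Admissibility of \<open>D\<close> is used at the pushed plot: the natural map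
      of \<open>p\<close> is \<open>?\<Psi>\<close> after the natural map of the composite of
      \<open>p\<close> with \<open>f\<close>.\<close>
    have fq: "(n, U, compose U f p) \<in> plots X" using dspace_isoD(7)[OF i q] .
    have gf: "compose U g (compose U f p) = p" using push_plot_inverse[OF X' i q] by simp
    show ?thesis
    proof (rule smooth_map_transfer[OF dspace_iso_refl[OF P] I P A(2)[OF fq]])
      fix a assume "a \<in> points ?P"
      then obtain u v where "a = (u, v)" "u \<in> U" by auto
      then show "natural_map X (n, U, p) a = ?\<Psi> (natural_map X (n, U, compose U f p) a)"
        using natural_map_push_plot[OF X i' fq, of u v] gf by simp
    qed
  qed
  show ?thesis
    unfolding admissible_tangent_diffeology_def Let_def Ball_triple
    using diffeological_space_transfer[OF I A(1) E'] nat zero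
      smooth_fiberwise_operations_transfer[OF B A(3)] by blast
qed

theorem natural_internal_tangent_bundle:
  assumes X: "diffeological_space X"
  shows "natural_bundle (internal_tangent_bundle X)"
proof -
  let ?D = "\<Inter>{D. admissible_tangent_diffeology X D}"
  let ?F = "internal_tangent_with X ?D"
  note X' = diffeological_imp_proper[OF X]
  have "p \<in> U \<rightarrow>\<^sub>E internal_tangent_points X \<and> openin (Euclidean_space n) U" if "(n, U, p) \<in> ?D" for n U p
    using admissible_indiscrete[OF X] that by blast
  then have E: "proper_plots (total_space ?F)" unfolding proper_plots_iff by simp
  \<comment> \<open>Stated for every inverse pair, since it is applied to the diffeomorphism and to
    its inverse.\<close>
  have smooth: "smooth_map (total_space ?F) (total_space ?F) (tangent_lift X f g)"
    if i: "dspace_iso X X f g" for f g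
  proof (rule smooth_mapI)
    fix n U p assume p: "(n, U, p) \<in> plots (total_space ?F)"
    \<comment> \<open>The pullback of \<open>D\<close> is one of the diffeologies being intersected,
      so it contains \<open>p\<close>; by its definition the lifted plot then lies in
      \<open>D\<close>.\<close>
    have "(n, U, compose U (tangent_lift X f g) p) \<in> D" if "admissible_tangent_diffeology X D" for D
      using p admissible_pullback[OF X i that] by auto
    then show "(n, U, compose U (tangent_lift X f g) p) \<in> plots (total_space ?F)" by simp
  qed (simp add: tangent_lift_points[OF X' i])
  have "bundle_iso ?F ?F f g (tangent_lift X f g) (tangent_lift X g f)" if i: "dspace_iso X X f g" for f g
  proof (rule tangent_bundle_iso[OF X' i E E])
    note i' = dspace_iso_sym[OF i]
    show "dspace_iso (total_space ?F) (total_space ?F) (tangent_lift X f g) (tangent_lift X g f)"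
      unfolding dspace_iso_def
      using smooth[OF i] smooth[OF i'] tangent_lift_inverse[OF X' i] tangent_lift_inverse[OF X' i'] by simp
  qed
  then show ?thesis
    using X E diffeomorphism_dspace_iso[OF X']
    unfolding natural_bundle_def internal_tangent_bundle_def internal_tangent_with_simps by blast
qed

theorem theorem4p8:
  fixes X :: "'a dspace" and \<phi> :: "'a \<Rightarrow> 'a"
  assumes "diffeological_space X"
    and "\<phi> \<in> diffeomorphisms X"
    and "smoothly_homotopic_to_id X \<phi>"
  shows "((\<forall>\<F>. fiber_collection (cotangent_bundle X) \<F> \<longrightarrow>
             (\<forall>V\<in>\<F>.
                (\<forall>C\<in>connected_components_of
                   (subtopology (D_topology X) (fiber_locus (cotangent_bundle X) V)). \<phi> ` C = C) \<and>
                (\<forall>C\<in>connected_components_of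
                   (D_topology (subset_dspace X (fiber_locus (cotangent_bundle X) V))). \<phi> ` C = C))) \<and>
          (\<forall>x. isolated_F_singularity (cotangent_bundle X) x \<longrightarrow> \<phi> x = x)) \<and>
         ((\<forall>\<F>. fiber_collection (internal_tangent_bundle X) \<F> \<longrightarrow>
             (\<forall>V\<in>\<F>.
                (\<forall>C\<in>connected_components_of
                   (subtopology (D_topology X) (fiber_locus (internal_tangent_bundle X) V)). \<phi> ` C = C) \<and>
                (\<forall>C\<in>connected_components_of
                   (D_topology (subset_dspace X (fiber_locus (internal_tangent_bundle X) V))). \<phi> ` C = C))) \<and>
          (\<forall>x. isolated_F_singularity (internal_tangent_bundle X) x \<longrightarrow> \<phi> x = x))"
proof -
  have c: "base_space (cotangent_bundle X) = X" by (simp add: cotangent_bundle_def)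
  have t: "base_space (internal_tangent_bundle X) = X" by (simp add: internal_tangent_bundle_def)
  note C = natural_bundle_homotopy[OF natural_cotangent_bundle[OF assms(1)], unfolded c, OF assms(2,3)]
  note T = natural_bundle_homotopy[OF natural_internal_tangent_bundle[OF assms(1)], unfolded t, OF assms(2,3)]
  show ?thesis
    by (intro conjI allI impI ballI; (rule C(2) T(2) C(1)[THEN conjunct1, rule_format]
        C(1)[THEN conjunct2, rule_format] T(1)[THEN conjunct1, rule_format]
        T(1)[THEN conjunct2, rule_format]; assumption))
qed

end
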